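(* Let $G$ be a non-elementary word-hyperbolic group and let $a \in G$ be an element whose conjugacy class in $G$ is infinite. Then every trace $\tau : C^*_{\mathrm{red}}(G) \to \mathbb{C}$ satisfies $\tau(a) = 0$.
   Context: Let $G$ be a finitely generated discrete group with a finite generating set, and consider the Cayley graph of $G$ as a geodesic metric space in which each edge is identified with the unit interval. For $\delta>0$, $G$ is $\delta$-hyperbolic if for all $x,y,z \in G$ one has $[x,y] \subset B_\delta([y,z]\cup[z,x])$, where $[x,y]$ denotes a geodesic between $x$ and $y$ and $B_\delta(X)$ is the set of points at distance less than $\delta$ from some point of $X$; $G$ is (word-)hyperbolic if it is $\delta$-hyperbolic for some $\delta>0$. $G$ is called elementary if it contains $\mathbb{Z}$ as a finite index subgroup, and non-elementary otherwise. The group $G$ acts on $\ell^2(G)$ by bounded operators (the regular representation), giving a map $\mathbb{C}[G] \to B(\ell^2(G))$; the reduced group $C^*$-algebra $C^*_{\mathrm{red}}(G)$ is the operator norm closure of $\mathbb{C}[G]$ in $B(\ell^2(G))$. Elements of $G$ are regarded as elements of $C^*_{\mathrm{red}}(G)$. A trace on $C^*_{\mathrm{red}}(G)$ is a bounded linear map $\tau : C^*_{\mathrm{red}}(G) \to \mathbb{C}$ (not necessarily positive) with $\tau(xy)=\tau(yx)$ for all $x,y$. *)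

theory Defs
  imports "HOL-Algebra.Elementary_Groups" "HOL-Algebra.Generated_Groups" "HOL-Analysis.Infinite_Sum"
begin

section \<open>Cayley graphs as geodesic metric spaces\<close>

text \<open>
  The Cayley graph is taken as a simple undirected graph: loops (coming from the unit element) and
  parallel edges (coming from a generator together with its inverse) are discarded.
\<close>

definition cayley_edges :: "('a, 'b) monoid_scheme \<Rightarrow> 'a set \<Rightarrow> ('a \<times> 'a) set" where
  "cayley_edges G S = {(u, v). u \<in> carrier G \<and> v \<in> carrier G \<and> u \<noteq> v \<and>
     (\<exists>s\<in>S. v = u \<otimes>\<^bsub>G\<^esub> s \<or> u = v \<otimes>\<^bsub>G\<^esub> s)}"

definition vertex_dist :: "('a, 'b) monoid_scheme \<Rightarrow> 'a set \<Rightarrow> 'a \<Rightarrow> 'a \<Rightarrow> nat" where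
  "vertex_dist G S u v = (LEAST n. (u, v) \<in> cayley_edges G S ^^ n)"

text \<open>
  Points of the geometric realization are given by barycentric coordinates: \<open>edge_point u v t\<close> is
  the point at distance \<open>t\<close> from \<open>u\<close> on the edge from \<open>u\<close> to \<open>v\<close>. This makes the
  identification of the end points of edges, and of an edge with its reverse, automatic.
\<close>

definition edge_point :: "'a \<Rightarrow> 'a \<Rightarrow> real \<Rightarrow> 'a \<Rightarrow> real" where
  "edge_point u v t = (\<lambda>x. (1 - t) * of_bool (x = u) + t * of_bool (x = v))"

definition vertex_point :: "'a \<Rightarrow> 'a \<Rightarrow> real" where
  "vertex_point u = (\<lambda>x. of_bool (x = u))"

definition cayley_graph :: "('a, 'b) monoid_scheme \<Rightarrow> 'a set \<Rightarrow> ('a \<Rightarrow> real) set" where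
  "cayley_graph G S = vertex_point ` carrier G \<union>
     {edge_point u v t | u v t. (u, v) \<in> cayley_edges G S \<and> 0 \<le> t \<and> t \<le> 1}"

definition point_support :: "('a \<Rightarrow> real) \<Rightarrow> 'a set" where
  "point_support p = {x. p x \<noteq> 0}"

text \<open>
  The path metric with all edges of length 1. On a common edge the distance is the difference of
  the parameters, which is half the \<open>L\<^sup>1\<close>-distance of the barycentric coordinates. Otherwise a
  shortest path leaves the edge of \<open>p\<close> through an end point \<open>u\<close>, at distance \<open>1 - p u\<close> from
  \<open>p\<close>, and enters the edge of \<open>q\<close> through an end point \<open>v\<close>.
\<close>

definition cayley_dist ::
    "('a, 'b) monoid_scheme \<Rightarrow> 'a set \<Rightarrow> ('a \<Rightarrow> real) \<Rightarrow> ('a \<Rightarrow> real) \<Rightarrow> real" where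
  "cayley_dist G S p q =
     (if \<exists>(u, v) \<in> cayley_edges G S. point_support p \<union> point_support q \<subseteq> {u, v}
      then (\<Sum>x \<in> point_support p \<union> point_support q. \<bar>p x - q x\<bar>) / 2
      else Min {(1 - p u) + real (vertex_dist G S u v) + (1 - q v) | u v.
                  u \<in> point_support p \<and> v \<in> point_support q})"

section \<open>Hyperbolic and elementary groups\<close>

definition geodesic_segment :: "'p set \<Rightarrow> ('p \<Rightarrow> 'p \<Rightarrow> real) \<Rightarrow> 'p \<Rightarrow> 'p \<Rightarrow> 'p set \<Rightarrow> bool" where
  "geodesic_segment M d x y I \<longleftrightarrow>
     (\<exists>c. c 0 = x \<and> c (d x y) = y \<and> c ` {0..d x y} \<subseteq> M \<and>
          (\<forall>s\<in>{0..d x y}. \<forall>t\<in>{0..d x y}. d (c s) (c t) = \<bar>s - t\<bar>) \<and>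
          I = c ` {0..d x y})"

definition open_nbhd :: "'p set \<Rightarrow> ('p \<Rightarrow> 'p \<Rightarrow> real) \<Rightarrow> real \<Rightarrow> 'p set \<Rightarrow> 'p set" where
  "open_nbhd M d \<delta> X = {p \<in> M. \<exists>q\<in>X. d p q < \<delta>}"

text \<open>The vertices of the triangles are group elements, and all choices of geodesics are allowed.\<close>

definition delta_hyperbolic :: "('a, 'b) monoid_scheme \<Rightarrow> 'a set \<Rightarrow> real \<Rightarrow> bool" where
  "delta_hyperbolic G S \<delta> \<longleftrightarrow>
     (\<forall>x\<in>carrier G. \<forall>y\<in>carrier G. \<forall>z\<in>carrier G. \<forall>I J K.
        geodesic_segment (cayley_graph G S) (cayley_dist G S) (vertex_point x) (vertex_point y) I \<longrightarrow>
        geodesic_segment (cayley_graph G S) (cayley_dist G S) (vertex_point y) (vertex_point z) J \<longrightarrow>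
        geodesic_segment (cayley_graph G S) (cayley_dist G S) (vertex_point z) (vertex_point x) K \<longrightarrow>
        I \<subseteq> open_nbhd (cayley_graph G S) (cayley_dist G S) \<delta> (J \<union> K))"

definition word_hyperbolic :: "('a, 'b) monoid_scheme \<Rightarrow> bool" where
  "word_hyperbolic G \<longleftrightarrow>
     (\<exists>S. finite S \<and> S \<subseteq> carrier G \<and> generate G S = carrier G \<and>
          (\<exists>\<delta>>0. delta_hyperbolic G S \<delta>))"

text \<open>With this convention finite groups are not elementary.\<close>

definition elementary_group :: "('a, 'b) monoid_scheme \<Rightarrow> bool" where
  "elementary_group G \<longleftrightarrow>
     (\<exists>H. subgroup H G \<and> finite (rcosets\<^bsub>G\<^esub> H) \<and> G\<lparr>carrier := H\<rparr> \<cong> integer_group)"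

definition conjugacy_class :: "('a, 'b) monoid_scheme \<Rightarrow> 'a \<Rightarrow> 'a set" where
  "conjugacy_class G a = {g \<otimes>\<^bsub>G\<^esub> a \<otimes>\<^bsub>G\<^esub> inv\<^bsub>G\<^esub> g | g. g \<in> carrier G}"

section \<open>The reduced group C*-algebra\<close>

text \<open>
  Elements of \<open>\<ell>\<^sup>2(A)\<close> are functions on the ambient type that vanish off \<open>A\<close>. Likewise,
  operators on \<open>\<ell>\<^sup>2(A)\<close> are represented by functions that are zero off \<open>\<ell>\<^sup>2(A)\<close>, so that
  equality of operators is equality of functions, and sums, scalar multiples and composites of
  operators are the pointwise ones and ordinary composition.
\<close>

definition ell2 :: "'a set \<Rightarrow> ('a \<Rightarrow> complex) set" where
  "ell2 A = {\<xi>. (\<forall>x. x \<notin> A \<longrightarrow> \<xi> x = 0) \<and> (\<lambda>x. (cmod (\<xi> x))\<^sup>2) summable_on A}"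

definition ell2_norm :: "'a set \<Rightarrow> ('a \<Rightarrow> complex) \<Rightarrow> real" where
  "ell2_norm A \<xi> = sqrt (\<Sum>\<^sub>\<infinity>x\<in>A. (cmod (\<xi> x))\<^sup>2)"

type_synonym 'a operator = "('a \<Rightarrow> complex) \<Rightarrow> ('a \<Rightarrow> complex)"

definition bounded_operators :: "'a set \<Rightarrow> 'a operator set" where
  "bounded_operators A = {T.
     (\<forall>\<xi>\<in>ell2 A. T \<xi> \<in> ell2 A) \<and>
     (\<forall>\<xi>. \<xi> \<notin> ell2 A \<longrightarrow> T \<xi> = (\<lambda>x. 0)) \<and>
     (\<forall>\<xi>\<in>ell2 A. \<forall>\<eta>\<in>ell2 A. T (\<lambda>x. \<xi> x + \<eta> x) = (\<lambda>x. T \<xi> x + T \<eta> x)) \<and>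
     (\<forall>c. \<forall>\<xi>\<in>ell2 A. T (\<lambda>x. c * \<xi> x) = (\<lambda>x. c * T \<xi> x)) \<and>
     (\<exists>K. \<forall>\<xi>\<in>ell2 A. ell2_norm A (T \<xi>) \<le> K * ell2_norm A \<xi>)}"

definition op_norm :: "'a set \<Rightarrow> 'a operator \<Rightarrow> real" where
  "op_norm A T = (SUP \<xi> \<in> {\<xi> \<in> ell2 A. ell2_norm A \<xi> \<le> 1}. ell2_norm A (T \<xi>))"

definition op_add :: "'a operator \<Rightarrow> 'a operator \<Rightarrow> 'a operator" where
  "op_add T U = (\<lambda>\<xi> x. T \<xi> x + U \<xi> x)"

definition op_scale :: "complex \<Rightarrow> 'a operator \<Rightarrow> 'a operator" where
  "op_scale c T = (\<lambda>\<xi> x. c * T \<xi> x)"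

definition op_diff :: "'a operator \<Rightarrow> 'a operator \<Rightarrow> 'a operator" where
  "op_diff T U = (\<lambda>\<xi> x. T \<xi> x - U \<xi> x)"

definition regular_rep :: "('a, 'b) monoid_scheme \<Rightarrow> 'a \<Rightarrow> 'a operator" where
  "regular_rep G g = (\<lambda>\<xi> x. if \<xi> \<in> ell2 (carrier G) \<and> x \<in> carrier G
                            then \<xi> (inv\<^bsub>G\<^esub> g \<otimes>\<^bsub>G\<^esub> x) else 0)"

definition group_ring :: "('a, 'b) monoid_scheme \<Rightarrow> ('a \<Rightarrow> complex) set" where
  "group_ring G = {f. finite {g. f g \<noteq> 0} \<and> {g. f g \<noteq> 0} \<subseteq> carrier G}"

definition group_ring_rep :: "('a, 'b) monoid_scheme \<Rightarrow> ('a \<Rightarrow> complex) \<Rightarrow> 'a operator" where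
  "group_ring_rep G f = (\<lambda>\<xi> x. \<Sum>g | f g \<noteq> 0. f g * regular_rep G g \<xi> x)"

definition reduced_cstar :: "('a, 'b) monoid_scheme \<Rightarrow> 'a operator set" where
  "reduced_cstar G = {T \<in> bounded_operators (carrier G).
     \<forall>\<epsilon>>0. \<exists>f\<in>group_ring G. op_norm (carrier G) (op_diff T (group_ring_rep G f)) < \<epsilon>}"

definition cstar_trace :: "('a, 'b) monoid_scheme \<Rightarrow> ('a operator \<Rightarrow> complex) \<Rightarrow> bool" where
  "cstar_trace G \<tau> \<longleftrightarrow>
     (\<forall>x\<in>reduced_cstar G. \<forall>y\<in>reduced_cstar G. \<tau> (op_add x y) = \<tau> x + \<tau> y) \<and>
     (\<forall>c. \<forall>x\<in>reduced_cstar G. \<tau> (op_scale c x) = c * \<tau> x) \<and>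
     (\<exists>K. \<forall>x\<in>reduced_cstar G. cmod (\<tau> x) \<le> K * op_norm (carrier G) x) \<and>
     (\<forall>x\<in>reduced_cstar G. \<forall>y\<in>reduced_cstar G. \<tau> (x \<circ> y) = \<tau> (y \<circ> x))"

end

theory Submission
  imports Defs "HOL-Analysis.Convex"
begin

text \<open>
  A trace is invariant under conjugation, so it takes the value \<open>\<tau> a\<close> on every average of \<open>N\<close>
  conjugates of \<open>a\<close>, and being bounded it is at most a constant times the operator norm of such an
  average. It therefore suffices to find conjugates whose averages have small norm. Following
  Powers, this happens when conjugates \<open>h\<^sub>j\<close> come with pairwise disjoint sets \<open>E\<^sub>j \<subseteq> G\<close> such that
  \<open>h\<^sub>j\<close> maps the complement of \<open>E\<^sub>j\<close> into \<open>E\<^sub>j\<close>: the average of \<open>N\<close> of them has norm at most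
  \<open>2 / \<surd>N\<close> (\<open>powers_average_norm\<close>), so \<open>\<tau> a = 0\<close> (\<open>trace_vanishes_of_powers_family\<close>).

  Such conjugates come from ping-pong, carried out directly with Gromov products on the group
  instead of on its boundary. An infinite hyperbolic group contains an element \<open>p\<close> whose powers form
  a quasi-geodesic axis (\<open>exists_quasi_axis\<close>). If every translate of the axis had unbounded overlap
  with the axis, then by local finiteness every element would conjugate a nontrivial power of \<open>p\<close> to
  a power of \<open>p\<close>, hence stay uniformly close to the axis, and the infinite cyclic group generated by
  \<open>p\<close> would have finite index. So in a non-elementary group there is an \<open>x\<close> such that the axis and
  its translate by \<open>x\<close> have bounded overlap (\<open>elementary_or_transverse\<close>), and \<open>p\<close> and
  \<open>q = x p x\<^sup>-\<^sup>1\<close> behave like free generators.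

  Since the conjugacy class of \<open>a\<close> is infinite, it contains an arbitrarily long element \<open>b\<close>. A given
  element can point in the direction of at most one of the three divergent long elements \<open>p\<^sup>m\<close>,
  \<open>p\<^sup>-\<^sup>m\<close>, \<open>q\<^sup>m\<close>, so one of them, called \<open>t\<^sup>-\<^sup>1\<close>, is avoided by both \<open>b\<close> and \<open>b\<^sup>-\<^sup>1\<close>. With
  \<open>s \<in> {p, q}\<close> the generator not involved in \<open>t\<close>, the elements \<open>g\<^sub>j = s\<^sup>n\<^sup>j t\<close> point in
  different directions, and \<open>g\<^sub>j b g\<^sub>j\<^sup>-\<^sup>1\<close> sends everything outside the set \<open>E\<^sub>j\<close> of elements pointing
  in the direction of \<open>g\<^sub>j\<close> into \<open>E\<^sub>j\<close> (\<open>powers_family_of_direction\<close>).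

  The only geometry in these arguments is the four-point inequality for the word length, together
  with finiteness of balls and the existence of geodesic words. The inequality is derived from thin
  triangles in the geometric realization of the Cayley graph, after edge paths have been extended to
  geodesics of the realization.
\<close>

section \<open>Groups with a hyperbolic length function\<close>

text \<open>
  The axiom \<open>split\<close> is what remains of the fact that the Cayley graph is geodesic, and \<open>finite_ball\<close>
  is local finiteness; the other axioms make \<open>len (x\<^sup>-\<^sup>1 y)\<close> a left-invariant distance that is
  hyperbolic in the sense of the four-point condition.
\<close>

locale hyperbolic_length = group G for G (structure) +
  fixes len :: "'a \<Rightarrow> real" and \<delta> :: real
  assumes len_one: "len \<one> = 0"
    and len_inv: "x \<in> carrier G \<Longrightarrow> len (inv x) = len x"
    and len_mult: "\<lbrakk>x \<in> carrier G; y \<in> carrier G\<rbrakk> \<Longrightarrow> len (x \<otimes> y) \<le> len x + len y"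
    and finite_ball: "finite {x \<in> carrier G. len x \<le> r}"
    and split: "\<lbrakk>x \<in> carrier G; real n \<le> len x\<rbrakk> \<Longrightarrow>
      \<exists>u\<in>carrier G. \<exists>v\<in>carrier G. x = u \<otimes> v \<and> len u = real n \<and> len v = len x - real n"
    and four_point: "\<lbrakk>w \<in> carrier G; x \<in> carrier G; y \<in> carrier G; z \<in> carrier G\<rbrakk> \<Longrightarrow>
      len (inv w \<otimes> x) + len (inv y \<otimes> z) \<le>
      max (len (inv w \<otimes> y) + len (inv x \<otimes> z)) (len (inv w \<otimes> z) + len (inv x \<otimes> y)) + 2 * \<delta>"
begin

definition len_dist :: "'a \<Rightarrow> 'a \<Rightarrow> real" where
  "len_dist x y = len (inv x \<otimes> y)"

definition gromov :: "'a \<Rightarrow> 'a \<Rightarrow> 'a \<Rightarrow> real" where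
  "gromov w x y = (len_dist w x + len_dist w y - len_dist x y) / 2"

lemma len_dist_one [simp]: "x \<in> carrier G \<Longrightarrow> len_dist \<one> x = len x"
  by (simp add: len_dist_def)

lemma len_dist_refl [simp]: "x \<in> carrier G \<Longrightarrow> len_dist x x = 0"
  by (simp add: len_dist_def len_one)

lemma len_dist_sym: "\<lbrakk>x \<in> carrier G; y \<in> carrier G\<rbrakk> \<Longrightarrow> len_dist x y = len_dist y x"
  using len_inv[of "inv x \<otimes> y"] by (simp add: len_dist_def inv_mult_group)

lemma len_dist_left [simp]:
  "\<lbrakk>g \<in> carrier G; x \<in> carrier G; y \<in> carrier G\<rbrakk> \<Longrightarrow> len_dist (g \<otimes> x) (g \<otimes> y) = len_dist x y"
  by (simp add: len_dist_def inv_mult_group m_assoc inv_solve_left) (simp add: m_assoc[symmetric])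

lemma len_dist_triangle:
  assumes "x \<in> carrier G" "y \<in> carrier G" "z \<in> carrier G"
  shows "len_dist x z \<le> len_dist x y + len_dist y z"
proof -
  have "inv x \<otimes> z = (inv x \<otimes> y) \<otimes> (inv y \<otimes> z)"
    using assms by (simp add: m_assoc) (simp add: m_assoc[symmetric])
  then show ?thesis
    using len_mult[of "inv x \<otimes> y" "inv y \<otimes> z"] assms by (simp add: len_dist_def)
qed

lemma len_nonneg: "x \<in> carrier G \<Longrightarrow> 0 \<le> len x"
  using len_mult[of x "inv x"] by (simp add: len_inv len_one)

lemma delta_nonneg: "0 \<le> \<delta>"
  using four_point[of \<one> \<one> \<one> \<one>] by (simp add: len_one)

lemma gromov_sym: "\<lbrakk>x \<in> carrier G; y \<in> carrier G\<rbrakk> \<Longrightarrow> gromov w x y = gromov w y x"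
  by (simp add: gromov_def len_dist_sym)

lemma gromov_left [simp]:
  "\<lbrakk>g \<in> carrier G; w \<in> carrier G; x \<in> carrier G; y \<in> carrier G\<rbrakk>
    \<Longrightarrow> gromov (g \<otimes> w) (g \<otimes> x) (g \<otimes> y) = gromov w x y"
  by (simp add: gromov_def)

text \<open>
  The form in which hyperbolicity is mostly used below: if \<open>x\<close> and \<open>y\<close> point in the same direction from
  \<open>w\<close> and \<open>z\<close> does not point in the direction of \<open>x\<close>, then it does not point in that of \<open>y\<close> either.
\<close>

lemma gromov_separate:
  assumes "w \<in> carrier G" "x \<in> carrier G" "y \<in> carrier G" "z \<in> carrier G"
    and "gromov w x z \<le> r" "r + \<delta> < gromov w x y"
  shows "gromov w y z \<le> r + \<delta>"
proof -
  have "len_dist w y + len_dist x z \<le> max (len_dist w x + len_dist y z) (len_dist w z + len_dist x y) + 2 * \<delta>"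
    using four_point[of w y x z] assms len_dist_sym[of x y] by (simp add: len_dist_def)
  then show ?thesis
    using assms(5,6) unfolding gromov_def by (auto simp: max_def split: if_splits)
qed

text \<open>
  Left translation by \<open>g\<^sup>-\<^sup>1\<close> exchanges the base points \<open>\<one>\<close> and \<open>g\<close>, and the Gromov products at the two
  ends of a side of a triangle add up to the length of that side. Thus a product \<open>g\<^sup>-\<^sup>1 y\<close> with little
  cancellation starts out in the direction of \<open>g\<^sup>-\<^sup>1\<close>.
\<close>

lemma gromov_flip:
  assumes "g \<in> carrier G" "y \<in> carrier G"
  shows "gromov \<one> (inv g) (inv g \<otimes> y) = len g - gromov \<one> g y"
proof -
  have "len_dist (inv g) (inv g \<otimes> y) = len_dist (inv g \<otimes> \<one>) (inv g \<otimes> y)"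
    using assms by simp
  also have "\<dots> = len y"
    using assms by (subst len_dist_left) auto
  finally show ?thesis
    using assms by (simp add: gromov_def len_inv len_dist_def[of g] field_simps)
qed

lemma gromov_move:
  assumes "w \<in> carrier G" "x \<in> carrier G" "y \<in> carrier G" "z \<in> carrier G"
  shows "gromov w x z \<le> gromov w y z + len_dist x y"
  using len_dist_triangle[of w y x] len_dist_triangle[of y x z] assms len_dist_sym[of x y]
  by (simp add: gromov_def field_simps)

lemma gromov_move_base:
  assumes "v \<in> carrier G" "w \<in> carrier G" "x \<in> carrier G" "y \<in> carrier G"
  shows "gromov v x y \<le> gromov w x y + len_dist v w"
  using len_dist_triangle[of v w x] len_dist_triangle[of v w y] assms
  by (simp add: gromov_def field_simps)

lemma gromov_le:
  assumes "w \<in> carrier G" "x \<in> carrier G" "y \<in> carrier G"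
  shows "gromov w x y \<le> len_dist w x"
  using len_dist_triangle[of w x y] assms by (simp add: gromov_def)

lemma unbounded_length:
  assumes "infinite A" "A \<subseteq> carrier G"
  shows "\<exists>x\<in>A. r < len x"
proof (rule ccontr)
  assume "\<not> ?thesis"
  then have "A \<subseteq> {x \<in> carrier G. len x \<le> r}" using assms by force
  then show False using finite_ball[of r] assms finite_subset by blast
qed

end

section \<open>Elements with a quasi-geodesic axis\<close>

text \<open>
  Little cancellation in \<open>p \<otimes> p\<close>, compared with the length of \<open>p\<close>, already forces little cancellation
  between all positive powers, by local-to-global induction. So the powers of \<open>p\<close> form a quasi-geodesic line.
\<close>

locale quasi_axis = hyperbolic_length +
  fixes p :: 'a and R :: real
  assumes p_closed [simp]: "p \<in> carrier G"
    and p_straight: "gromov \<one> (inv p) p \<le> R"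
    and p_long: "2 * R + 4 * \<delta> < len p"
    and R_nonneg: "0 \<le> R"
begin

abbreviation P :: "int \<Rightarrow> 'a" where "P k \<equiv> p [^] k"

text \<open>
  The detour made by visiting a power of \<open>p\<close> on the way between a lower and a higher one is at most
  \<open>2 * C\<close>.
\<close>

abbreviation C :: real where "C \<equiv> R + 2 * \<delta>"

lemma len_dist_pow: "len_dist (inv (p [^] (n::nat))) p = len (p [^] Suc n)"
  by (simp add: len_dist_def)

lemma straight_pow: "gromov \<one> (inv (p [^] (n::nat))) p \<le> R + \<delta>"
proof (induction n)
  case 0
  then show ?case using R_nonneg delta_nonneg by (simp add: gromov_def len_one)
next
  case (Suc n)
  have e: "inv (p [^] Suc n) = inv p \<otimes> inv (p [^] n)"
    by (simp add: inv_mult_group)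
  have "gromov \<one> (inv p) (inv (p [^] Suc n)) = len p - gromov \<one> p (inv (p [^] n))"
    unfolding e by (rule gromov_flip) auto
  then have "R + \<delta> < gromov \<one> (inv p) (inv (p [^] Suc n))"
    using Suc p_long delta_nonneg gromov_sym[of p "inv (p [^] n)" \<one>] by simp
  then show ?case
    using gromov_separate[OF _ _ _ _ p_straight] by simp
qed

lemma len_pow_ge: "real n * (len p - 2 * R - 2 * \<delta>) \<le> len (p [^] (n::nat))"
proof (induction n)
  case (Suc n)
  have "len (p [^] Suc n) = len (p [^] n) + len p - 2 * gromov \<one> (inv (p [^] n)) p"
    unfolding gromov_def len_dist_pow by (simp add: len_inv field_simps del: nat_pow_Suc)
  then show ?case using Suc straight_pow[of n] by (simp add: algebra_simps)
qed (simp add: len_one)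

lemma straight_pow_pow: "gromov \<one> (inv (p [^] (n::nat))) (p [^] (m::nat)) \<le> C"
proof (cases m)
  case 0
  then show ?thesis using R_nonneg delta_nonneg len_dist_sym[of "inv (p [^] n)" \<one>]
    by (simp add: gromov_def len_one)
next
  case (Suc k)
  have "len_dist (inv p) (p [^] k) = len_dist (inv (p [^] k)) p"
    by (simp add: len_dist_def nat_pow_Suc2[symmetric])
  then have "gromov \<one> (inv p) (p [^] k) = gromov \<one> (inv (p [^] k)) p"
    by (simp add: gromov_def len_inv)
  moreover have "gromov \<one> p (p \<otimes> p [^] k) = len p - gromov \<one> (inv p) (p [^] k)"
    using gromov_flip[of "inv p" "p [^] k"] by (simp add: len_inv)
  ultimately have "R + 2 * \<delta> < gromov \<one> p (p [^] m)"
    using p_long straight_pow[of k] delta_nonneg by (simp add: Suc nat_pow_Suc2[symmetric])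
  then show ?thesis
    using gromov_separate[of \<one> p "p [^] m" "inv (p [^] n)" "R + \<delta>"] straight_pow[of n]
      gromov_sym[of p "inv (p [^] n)" \<one>] gromov_sym[of "p [^] m" "inv (p [^] n)" \<one>]
    by simp
qed

lemma len_P_abs: "len (P k) = len (p [^] nat \<bar>k\<bar>)"
proof (cases "0 \<le> k")
  case True
  then show ?thesis using int_pow_int[of G p "nat k"] by simp
next
  case False
  then have "P k = inv (p [^] nat \<bar>k\<bar>)" using int_pow_neg_int[of p "nat (- k)"] by simp
  then show ?thesis by (simp add: len_inv)
qed

lemma len_P: "real_of_int \<bar>k\<bar> * (len p - 2 * R - 2 * \<delta>) \<le> len (P k)"
  using len_pow_ge[of "nat \<bar>k\<bar>"] unfolding len_P_abs by simp

lemma len_P_unbounded: "\<exists>n\<ge>1. \<forall>k. n \<le> \<bar>k\<bar> \<longrightarrow> r < len (P k)"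
proof -
  define e where "e = len p - 2 * R - 2 * \<delta>"
  have e: "0 < e" using p_long delta_nonneg by (simp add: e_def)
  obtain n :: nat where n: "r < real n * e" using e reals_Archimedean3 by blast
  have "r < len (P k)" if "int n + 1 \<le> \<bar>k\<bar>" for k
  proof -
    have "real n \<le> real_of_int \<bar>k\<bar>" using that by linarith
    then have "real n * e \<le> real_of_int \<bar>k\<bar> * e" using e by (intro mult_right_mono) simp_all
    then show ?thesis using n len_P[of k] unfolding e_def by (meson less_le_trans order_trans)
  qed
  moreover have "1 \<le> int n + 1" by simp
  ultimately show ?thesis by blast
qed

lemma P_eq_iff: "P i = P j \<longleftrightarrow> i = j"
proof
  assume *: "P i = P j"
  have "P (i - j) = P i \<otimes> inv (P j)" by (rule int_pow_diff) simp
  then have "P (i - j) = \<one>" unfolding * by simp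
  then have "real_of_int \<bar>i - j\<bar> * (len p - 2 * R - 2 * \<delta>) \<le> 0"
    using len_P[of "i - j"] len_one by metis
  moreover have "0 < len p - 2 * R - 2 * \<delta>" using p_long delta_nonneg by linarith
  ultimately show "i = j" by (simp add: mult_le_0_iff)
qed auto

lemma len_P_le: "len (P k) \<le> \<bar>k\<bar> * len p"
proof -
  have *: "len (p [^] n) \<le> real n * len p" for n :: nat
  proof (induction n)
    case (Suc n)
    then show ?case using len_mult[of "p [^] n" p] by (simp add: algebra_simps)
  qed (simp add: len_one)
  show ?thesis using *[of "nat \<bar>k\<bar>"] unfolding len_P_abs by simp
qed

lemma P_between:
  assumes "i \<le> k" "k \<le> j"
  shows "gromov (P k) (P i) (P j) \<le> C"
proof -
  have "gromov (P k) (P i) (P j) = gromov (P k \<otimes> \<one>) (P k \<otimes> P (i - k)) (P k \<otimes> P (j - k))"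
    using int_pow_mult[OF p_closed, of k "i - k"] int_pow_mult[OF p_closed, of k "j - k"]
    by (simp del: gromov_left)
  also have "\<dots> = gromov \<one> (P (i - k)) (P (j - k))"
    by (rule gromov_left) auto
  also have "\<dots> = gromov \<one> (inv (p [^] nat (k - i))) (p [^] nat (j - k))"
    using assms int_pow_neg[of p "k - i"] int_pow_int[of G p "nat (k - i)"]
      int_pow_int[of G p "nat (j - k)"]
    by simp
  finally show ?thesis using straight_pow_pow by simp
qed

lemma len_dist_P_Suc: "len_dist (P (k - 1)) (P k) = len p"
  using len_dist_left[of "P (k - 1)" \<one> p] int_pow_mult[of p "k - 1" 1] by (simp del: len_dist_left)

text \<open>
  A discrete intermediate value argument: at \<open>i\<close> the product with \<open>P i\<close> seen from \<open>y\<close> is large, at \<open>j\<close> it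
  is small. At the first index \<open>k\<close> where it is small, the product with \<open>P j\<close> is small too, up to one
  step. So \<open>y\<close> is near a path from \<open>P i\<close> to \<open>P k\<close> as well as near one from \<open>P k\<close> to \<open>P j\<close>, hence
  near the point \<open>P k\<close> where they meet.
\<close>

lemma near_axis:
  assumes y: "y \<in> carrier G" and ij: "i \<le> j" and c: "gromov y (P i) (P j) \<le> c"
  shows "\<exists>k. len_dist y (P k) \<le> c + C + 2 * \<delta> + len p"
proof -
  define S where "S = {k \<in> {i..j}. gromov y (P i) (P k) \<le> c + \<delta>}"
  have fin: "finite S" by (rule finite_subset[of _ "{i..j}"]) (auto simp: S_def)
  have ne: "S \<noteq> {}" using ij c delta_nonneg by (auto simp: S_def)
  define k where "k = Min S"
  have kS: "k \<in> S" using Min_in[OF fin ne] by (simp add: k_def)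
  then have k: "i \<le> k" "k \<le> j" "gromov y (P i) (P k) \<le> c + \<delta>" by (auto simp: S_def)
  have lp: "0 \<le> len p" by (simp add: len_nonneg)
  show ?thesis
  proof (cases "k = i")
    case True
    then have "len_dist y (P i) \<le> c + \<delta>" using k by (simp add: gromov_def)
    then show ?thesis using lp delta_nonneg R_nonneg by (intro exI[of _ i]) simp
  next
    case False
    have "k - 1 \<notin> S" using Min_le[OF fin, of "k - 1"] by (auto simp: k_def)
    then have "c + \<delta> < gromov y (P i) (P (k - 1))" using k False by (auto simp: S_def)
    then have "gromov y (P (k - 1)) (P j) \<le> c + \<delta>"
      using gromov_separate[OF _ _ _ _ c] y by simp
    then have 1: "gromov y (P k) (P j) \<le> c + \<delta> + len p"
      using gromov_move[of y "P k" "P (k - 1)" "P j"] y len_dist_P_Suc[of k] len_dist_sym[of "P (k - 1)" "P k"]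
      by simp
    have 2: "gromov (P k) (P i) (P j) \<le> C" using k P_between by simp
    have "len_dist y (P k) + len_dist (P i) (P j) \<le>
        max (len_dist y (P i) + len_dist (P k) (P j)) (len_dist y (P j) + len_dist (P k) (P i)) + 2 * \<delta>"
      using four_point[of y "P k" "P i" "P j"] y by (simp add: len_dist_def)
    then have "len_dist y (P k) \<le> c + C + 2 * \<delta> + len p"
      using 1 2 k(3) len_dist_sym[of "P k" "P i"] lp unfolding gromov_def
      by (simp add: field_simps max_def split: if_splits)
    then show ?thesis by blast
  qed
qed

lemma near_axis_unordered:
  assumes "y \<in> carrier G" "gromov y (P i) (P j) \<le> c"
  shows "\<exists>k. len_dist y (P k) \<le> c + C + 2 * \<delta> + len p"
  using near_axis[of y i j c] near_axis[of y j i c] gromov_sym[of "P i" "P j" y] assms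
  by (cases "i \<le> j") auto

end

context quasi_axis
begin

lemma len_p_nonneg: "0 \<le> len p"
  by (simp add: len_nonneg)

text \<open>
  If \<open>x P i\<close> and \<open>P j\<close> have a large Gromov product, then long initial pieces of the axis and of its
  translate by \<open>x\<close> run alongside each other, at a distance \<open>T\<close> that does not depend on how long the
  pieces are. Once a piece has more vertices than there are elements of length at most \<open>T\<close>, two of the
  connecting elements coincide, and this gives the relation between powers of \<open>p\<close>.
\<close>

lemma commensurates_axis:
  assumes x: "x \<in> carrier G" and unb: "\<And>B. \<exists>i j. B < gromov \<one> (x \<otimes> P i) (P j)"
  shows "\<exists>m m'. m \<noteq> 0 \<and> x \<otimes> P m = P m' \<otimes> x"
proof -
  define Q where "Q k = x \<otimes> P k" for k
  have Q: "Q k \<in> carrier G" for k using x by (simp add: Q_def)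
  define r where "r = C + len x"
  define T where "T = r + \<delta> + C + 2 * \<delta> + len p"
  define F where "F = {y \<in> carrier G. len y \<le> T}"
  have finF: "finite F" unfolding F_def by (rule finite_ball)
  define N where "N = int (card F)"
  obtain i j where ij: "r + \<delta> + len x + N * len p < gromov \<one> (Q i) (P j)"
    using unb unfolding Q_def by blast
  have lenQ: "len (Q k) \<le> len x + \<bar>k\<bar> * len p" for k
    using len_mult[of x "P k"] len_P_le[of k] x unfolding Q_def by simp
  have "gromov \<one> (Q i) (P j) \<le> len (Q i)"
    using gromov_le[of \<one> "Q i" "P j"] Q by simp
  then have "N * len p < \<bar>i\<bar> * len p"
    using ij lenQ[of i] len_nonneg[OF x] R_nonneg delta_nonneg unfolding r_def by linarith
  then have "real_of_int N < real_of_int \<bar>i\<bar>"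
    by (rule mult_right_less_imp_less) (rule len_p_nonneg)
  then have iN: "N < \<bar>i\<bar>" by linarith
  \<comment> \<open>As \<open>Q k\<close> lies between \<open>Q 0\<close> and \<open>Q i\<close>, and \<open>Q i\<close> and \<open>P j\<close> look alike from \<open>Q k\<close>, it also lies
    near a path from \<open>\<one>\<close> to \<open>P j\<close>.\<close>
  have near: "\<exists>l. len_dist (Q k) (P l) \<le> T" if k: "min 0 i \<le> k" "k \<le> max 0 i" "\<bar>k\<bar> \<le> N" for k
  proof -
    have "gromov (P k) (P 0) (P i) \<le> C"
    proof (cases "0 \<le> i")
      case True
      then show ?thesis using k P_between[of 0 k i] by simp
    next
      case False
      then show ?thesis using k P_between[of i k 0] gromov_sym[of "P 0" "P i" "P k"] by simp
    qed
    then have "gromov (Q k) (Q 0) (Q i) \<le> C"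
      unfolding Q_def using x by (subst gromov_left) simp_all
    moreover have "gromov (Q k) \<one> (Q i) \<le> gromov (Q k) (Q 0) (Q i) + len_dist \<one> (Q 0)"
      by (rule gromov_move) (simp_all add: Q)
    moreover have "len_dist \<one> (Q 0) = len x" using x by (simp add: Q_def)
    ultimately have "gromov (Q k) (Q i) \<one> \<le> r"
      using gromov_sym[of \<one> "Q i" "Q k"] Q by (simp add: r_def)
    moreover have "r + \<delta> < gromov (Q k) (Q i) (P j)"
    proof -
      have "real_of_int \<bar>k\<bar> * len p \<le> N * len p"
        using k(3) len_p_nonneg by (intro mult_right_mono) linarith+
      moreover have "gromov \<one> (Q i) (P j) \<le> gromov (Q k) (Q i) (P j) + len (Q k)"
        using gromov_move_base[of \<one> "Q k" "Q i" "P j"] Q by simp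
      ultimately show ?thesis using ij lenQ[of k] by linarith
    qed
    ultimately have "gromov (Q k) (P j) \<one> \<le> r + \<delta>"
      by (rule gromov_separate[rotated 4]) (simp_all add: Q)
    then show ?thesis
      using near_axis_unordered[of "Q k" j 0 "r + \<delta>"] Q unfolding T_def by simp
  qed
  define K where "K = (if 0 \<le> i then {0..N} else {-N..0})"
  have "\<forall>k\<in>K. \<exists>l. len_dist (Q k) (P l) \<le> T"
  proof
    fix k assume "k \<in> K"
    then show "\<exists>l. len_dist (Q k) (P l) \<le> T"
      using iN by (intro near) (auto simp: K_def split: if_splits)
  qed
  then obtain l where l: "\<And>k. k \<in> K \<Longrightarrow> len_dist (Q k) (P (l k)) \<le> T" by metis
  define f where "f k = inv (P (l k)) \<otimes> Q k" for k
  have "f ` K \<subseteq> F"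
  proof
    fix y assume "y \<in> f ` K"
    then obtain k where k: "k \<in> K" "y = f k" by auto
    have "len (f k) = len_dist (P (l k)) (Q k)" by (simp add: f_def len_dist_def)
    also have "\<dots> \<le> T" using l[OF k(1)] len_dist_sym[of "Q k" "P (l k)"] Q by simp
    finally show "y \<in> F" using Q k by (simp add: F_def f_def)
  qed
  then have "card (f ` K) \<le> card F" by (rule card_mono[OF finF])
  moreover have "int (card K) = N + 1"
    by (simp add: K_def N_def)
  ultimately have "card (f ` K) < card K" by (simp add: N_def)
  then have "\<not> inj_on f K" using card_image by fastforce
  then obtain k k' where kk: "k \<noteq> k'" "f k = f k'" by (auto simp: inj_on_def)
  have "P (- l k) \<otimes> (x \<otimes> P k) = P (- l k') \<otimes> (x \<otimes> P k')"
    using kk(2) by (simp add: f_def Q_def int_pow_neg)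
  then have "P (l k') \<otimes> (P (- l k) \<otimes> (x \<otimes> P k)) \<otimes> P (- k')
      = P (l k') \<otimes> (P (- l k') \<otimes> (x \<otimes> P k')) \<otimes> P (- k')" by simp
  moreover have "P (l k') \<otimes> (P (- l k) \<otimes> (x \<otimes> P k)) \<otimes> P (- k')
      = (P (l k') \<otimes> P (- l k)) \<otimes> (x \<otimes> (P k \<otimes> P (- k')))"
    using x by (simp add: m_assoc)
  moreover have "P (l k') \<otimes> (P (- l k') \<otimes> (x \<otimes> P k')) \<otimes> P (- k')
      = (P (l k') \<otimes> P (- l k')) \<otimes> (x \<otimes> (P k' \<otimes> P (- k')))"
    using x by (simp add: m_assoc)
  moreover have "P a \<otimes> P b = P (a + b)" for a b by (rule int_pow_mult[symmetric]) simp
  ultimately have e: "P (l k' - l k) \<otimes> (x \<otimes> P (k - k')) = x"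
    using x by simp
  have "P (l k - l k') \<otimes> x = P (l k - l k') \<otimes> (P (l k' - l k) \<otimes> (x \<otimes> P (k - k')))"
    unfolding e ..
  also have "\<dots> = (P (l k - l k') \<otimes> P (l k' - l k)) \<otimes> (x \<otimes> P (k - k'))"
    using x by (intro m_assoc[symmetric]) simp_all
  also have "P (l k - l k') \<otimes> P (l k' - l k) = \<one>"
    using int_pow_mult[of p "l k - l k'" "l k' - l k"] by simp
  finally have "x \<otimes> P (k - k') = P (l k - l k') \<otimes> x" using x by simp
  then show ?thesis using kk(1) by (intro exI[of _ "k - k'"] exI) auto
qed

lemma intertwine_pow:
  assumes x: "x \<in> carrier G" and e: "x \<otimes> P m = P m' \<otimes> x"
  shows "x \<otimes> P (m * int K) = P (m' * int K) \<otimes> x"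
proof (induction K)
  case 0
  then show ?case using x by simp
next
  case (Suc K)
  have "x \<otimes> P (m * int (Suc K)) = x \<otimes> (P (m * int K) \<otimes> P m)"
    using int_pow_mult[of p "m * int K" m] by (simp add: algebra_simps)
  also have "\<dots> = (x \<otimes> P (m * int K)) \<otimes> P m" using x by (simp add: m_assoc)
  also have "\<dots> = P (m' * int K) \<otimes> (x \<otimes> P m)" using x by (simp add: Suc m_assoc)
  also have "\<dots> = (P (m' * int K) \<otimes> P m') \<otimes> x" using x by (simp add: e m_assoc)
  also have "P (m' * int K) \<otimes> P m' = P (m' * int (Suc K))"
    using int_pow_mult[of p "m' * int K" m'] by (simp add: algebra_simps)
  finally show ?case .
qed

lemma intertwine_neg:
  assumes x: "x \<in> carrier G" and e: "x \<otimes> P m = P m' \<otimes> x"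
  shows "x \<otimes> P (- m) = P (- m') \<otimes> x"
proof -
  have "P m' \<otimes> (x \<otimes> P (- m)) = x \<otimes> (P m \<otimes> P (- m))"
    using x by (simp add: m_assoc[symmetric] e)
  also have "\<dots> = x" using x by (simp add: int_pow_neg)
  finally have "P m' \<otimes> (x \<otimes> P (- m)) = x" .
  then have "x \<otimes> P (- m) = inv (P m') \<otimes> x"
    using x by (metis inv_solve_left int_pow_closed m_closed p_closed)
  then show ?thesis by (simp add: int_pow_neg)
qed

text \<open>
  The relation makes the translated axis \<open>x P k\<close> stay at distance \<open>len x\<close> from the axis at
  arbitrarily distant places on both sides of \<open>x\<close>. Between such places the two lines are uniformly
  close, so the bound on the distance from \<open>x\<close> to the axis no longer depends on \<open>x\<close>.
\<close>

lemma close_to_axis: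
  assumes x: "x \<in> carrier G" and m: "m \<noteq> 0" and e: "x \<otimes> P m = P m' \<otimes> x"
  shows "\<exists>k. len_dist x (P k) \<le> (C + 2 * \<delta>) + C + 2 * \<delta> + len p"
proof -
  obtain n where n: "1 \<le> n" "\<And>k. n \<le> \<bar>k\<bar> \<Longrightarrow> C + 2 * \<delta> + len x < len (P k)"
    using len_P_unbounded by blast
  define M M' where "M = m * int (nat n)" and "M' = m' * int (nat n)"
  have "n * 1 \<le> n * \<bar>m\<bar>" using n m by (intro mult_left_mono) auto
  then have big: "n \<le> \<bar>M\<bar>" "n \<le> \<bar>- M\<bar>" using n by (simp_all add: M_def abs_mult mult.commute)
  \<comment> \<open>Seen from \<open>x\<close>, the corresponding distant points of the two lines coincide.\<close>
  have far: "C + 2 * \<delta> < gromov x (x \<otimes> P k) (P k')"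
    if k: "n \<le> \<bar>k\<bar>" and kk: "x \<otimes> P k = P k' \<otimes> x" for k k'
  proof -
    have 1: "len_dist (x \<otimes> P k) (P k') = len x"
      using len_dist_left[of "P k'" x \<one>] x len_dist_sym[of x \<one>] by (simp add: kk del: len_dist_left)
    have 2: "len_dist x (x \<otimes> P k) = len (P k)"
      using len_dist_left[of x \<one> "P k"] x by (simp del: len_dist_left)
    have "len_dist x (x \<otimes> P k) \<le> len_dist x (P k') + len_dist (P k') (x \<otimes> P k)"
      using x by (intro len_dist_triangle) auto
    then show ?thesis
      using 1 2 n(2)[OF k] len_dist_sym[of "P k'" "x \<otimes> P k"] x by (simp add: gromov_def field_simps)
  qed
  have e1: "x \<otimes> P M = P M' \<otimes> x" unfolding M_def M'_def by (rule intertwine_pow[OF x e])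
  have e2: "x \<otimes> P (- M) = P (- M') \<otimes> x" by (rule intertwine_neg[OF x e1])
  have "gromov (P 0) (P M) (P (- M)) \<le> C"
    using P_between[of M 0 "- M"] P_between[of "- M" 0 M] gromov_sym[of "P M" "P (- M)" "P 0"]
    by (cases "0 \<le> M") auto
  then have "gromov x (x \<otimes> P M) (x \<otimes> P (- M)) \<le> C"
    using gromov_left[of x \<one> "P M" "P (- M)"] x by (simp del: gromov_left)
  then have "gromov x (P M') (x \<otimes> P (- M)) \<le> C + \<delta>"
    using far[OF big(1) e1] x delta_nonneg by (intro gromov_separate[of x "x \<otimes> P M"]) auto
  then have "gromov x (x \<otimes> P (- M)) (P M') \<le> C + \<delta>"
    using gromov_sym[of "P M'" "x \<otimes> P (- M)" x] x by simp
  then have "gromov x (P (- M')) (P M') \<le> C + \<delta> + \<delta>"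
    using far[OF big(2) e2] x delta_nonneg gromov_separate[of x "x \<otimes> P (- M)" "P (- M')" "P M'" "C + \<delta>"]
    by simp
  then show ?thesis using near_axis_unordered[of x "- M'" M' "C + 2 * \<delta>"] x by simp
qed

lemma elementary_if_close_to_axis:
  assumes "\<And>x. x \<in> carrier G \<Longrightarrow> \<exists>k. len_dist x (P k) \<le> T"
  shows "elementary_group G"
proof -
  define H where "H = range P"
  have H: "subgroup H G"
  proof
    show "H \<subseteq> carrier G" by (auto simp: H_def)
    show "\<one> \<in> H" unfolding H_def by (metis int_pow_0 rangeI)
    show "x \<otimes> y \<in> H" if "x \<in> H" "y \<in> H" for x y
      using that by (auto simp: H_def int_pow_mult[OF p_closed, symmetric])
    show "inv x \<in> H" if "x \<in> H" for x
      using that by (auto simp: H_def int_pow_neg[OF p_closed, symmetric])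
  qed
  have "rcosets H \<subseteq> (\<lambda>f. H #> f) ` {y \<in> carrier G. len y \<le> T}"
  proof
    fix X assume "X \<in> rcosets H"
    then obtain x where x: "x \<in> carrier G" "X = H #> x" by (auto simp: RCOSETS_def)
    obtain k where k: "len_dist x (P k) \<le> T" using assms x by blast
    define f where "f = P (- k) \<otimes> x"
    have "f \<in> H #> x" unfolding r_coset_def H_def f_def by blast
    then have "X = H #> f" using repr_independence[OF _ _ H] x by simp
    moreover have "len f = len_dist (P k) x" by (simp add: f_def len_dist_def int_pow_neg)
    then have "len f \<le> T" using k len_dist_sym[of x "P k"] x by simp
    moreover have "f \<in> carrier G" using x by (simp add: f_def)
    ultimately show "X \<in> (\<lambda>f. H #> f) ` {y \<in> carrier G. len y \<le> T}" by blast
  qed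
  then have "finite (rcosets H)" using finite_ball finite_surj by blast
  moreover have "P \<in> iso integer_group (G\<lparr>carrier := H\<rparr>)"
  proof -
    have "inj P" using P_eq_iff by (auto simp: inj_def)
    then have "bij_betw P UNIV H" unfolding H_def by (simp add: bij_betw_def)
    then show ?thesis
      by (auto simp: iso_def hom_def integer_group_def H_def int_pow_mult)
  qed
  then have "G\<lparr>carrier := H\<rparr> \<cong> integer_group"
    using group.iso_sym group_integer_group unfolding is_iso_def by blast
  ultimately show ?thesis using H unfolding elementary_group_def by blast
qed

lemma elementary_or_transverse:
  assumes "\<not> elementary_group G"
  shows "\<exists>x\<in>carrier G. \<exists>B. \<forall>i j. gromov \<one> (x \<otimes> P i) (P j) \<le> B"
proof (rule ccontr)
  assume "\<not> ?thesis"
  then have "\<exists>i j. B < gromov \<one> (x \<otimes> P i) (P j)" if "x \<in> carrier G" for x B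
    using that by (meson not_le)
  then have "\<exists>k. len_dist x (P k) \<le> (C + 2 * \<delta>) + C + 2 * \<delta> + len p" if "x \<in> carrier G" for x
    using commensurates_axis[of x] close_to_axis[of x] that by blast
  then show False using elementary_if_close_to_axis assms by blast
qed

end

context hyperbolic_length
begin

text \<open>
  The ends \<open>u\<close> and \<open>v\<close> of a long geodesic with midpoint \<open>\<one>\<close> have the same length and point in
  different directions. If neither satisfies the axis condition, then \<open>u\<^sup>-\<^sup>1\<close> points in the direction of \<open>u\<close>, and \<open>v\<^sup>-\<^sup>1\<close>
  in the direction of \<open>v\<close>. Hence neither \<open>u v\<close> nor \<open>v u\<close> has much cancellation, and \<open>u v\<close> has an axis.
\<close>

lemma exists_quasi_axis:
  assumes "infinite (carrier G)"
  shows "\<exists>p R. quasi_axis G len \<delta> p R"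
proof -
  obtain n :: nat where n: "30 * \<delta> + 20 < real n" using reals_Archimedean2 by blast
  obtain g where g: "g \<in> carrier G" "real (2 * n) < len g"
    using unbounded_length[OF assms] by blast
  obtain w w' where w: "w \<in> carrier G" "len w = real (2 * n)"
    using split[OF g(1), of "2 * n"] g by auto
  obtain u' v where uv: "u' \<in> carrier G" "v \<in> carrier G" "w = u' \<otimes> v" "len u' = real n" "len v = real n"
    using split[OF w(1), of n] w by auto
  define u where "u = inv u'"
  have u: "u \<in> carrier G" "len u = n" "len (inv u) = n" using uv by (auto simp: u_def len_inv)
  have lv: "len (inv v) = n" using uv by (simp add: len_inv)
  have gromov0: "gromov \<one> u v = 0" using uv u w by (simp add: gromov_def len_dist_def u_def)
  \<comment> \<open>The largest cancellation, up to a margin, for which an element of length \<open>n\<close> still has an axis.\<close>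
  define r where "r = real n / 2 - 10 * \<delta> - 1 / 2"
  have r: "0 \<le> r" "\<delta> < r" "2 * r + 4 * \<delta> < n"
    using n delta_nonneg by (simp_all add: r_def field_simps)
  have ax: "quasi_axis G len \<delta> p R'"
    if "p \<in> carrier G" "gromov \<one> (inv p) p \<le> R'" "2 * R' + 4 * \<delta> < len p" "0 \<le> R'" for p R'
    using that by unfold_locales auto
  consider "gromov \<one> (inv u) u \<le> r" | "gromov \<one> (inv v) v \<le> r" | "r < gromov \<one> (inv u) u" "r < gromov \<one> (inv v) v"
    by linarith
  then show ?thesis
  proof cases
    case 1
    then show ?thesis using ax[of u r] u r by auto
  next
    case 2
    then show ?thesis using ax[of v r] uv r by auto
  next
    case 3
    have iu: "gromov \<one> (inv u) v \<le> \<delta>"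
      using gromov_separate[of \<one> u "inv u" v 0] gromov0 3 r u uv gromov_sym[of u "inv u" \<one>] by simp
    have iv: "gromov \<one> (inv v) u \<le> \<delta>"
      using gromov_separate[of \<one> v "inv v" u 0] gromov0 3 r u uv gromov_sym[of v "inv v" \<one>] gromov_sym[of u v \<one>] by simp
    define p where "p = u \<otimes> v"
    have p: "p \<in> carrier G" using u uv by (simp add: p_def)
    have "len p = len_dist (inv u) v" using u by (simp add: p_def len_dist_def)
    then have lp: "2 * n - 2 * \<delta> \<le> len p" using iu u uv by (simp add: gromov_def)
    have "gromov \<one> u (u \<otimes> v) = len u - gromov \<one> (inv u) v"
      using gromov_flip[of "inv u" v] u uv by simp
    then have a: "n - \<delta> \<le> gromov \<one> u p" using iu u by (simp add: p_def)
    have "gromov \<one> (inv v) (inv v \<otimes> inv u) = len v - gromov \<one> v (inv u)"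
      using gromov_flip[of v "inv u"] u uv by simp
    then have b: "n - \<delta> \<le> gromov \<one> (inv v) (inv p)"
      using iu u uv gromov_sym[of v "inv u" \<one>] by (simp add: p_def inv_mult_group)
    have "gromov \<one> (inv p) u \<le> 2 * \<delta>"
      using gromov_separate[of \<one> "inv v" "inv p" u \<delta>] b iv u uv p n delta_nonneg by simp
    then have "gromov \<one> p (inv p) \<le> 3 * \<delta>"
      using gromov_separate[of \<one> u p "inv p" "2 * \<delta>"] a u uv p n delta_nonneg gromov_sym[of u "inv p" \<one>]
      by simp
    then have "gromov \<one> (inv p) p \<le> 3 * \<delta>" using gromov_sym[of p "inv p" \<one>] p by simp
    then show ?thesis using ax[of p "3 * \<delta>"] p lp n delta_nonneg by auto
  qed
qed

end

section \<open>Ping-pong with conjugates\<close>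

definition (in group) powers_family :: "'a \<Rightarrow> (nat \<Rightarrow> 'a) \<Rightarrow> (nat \<Rightarrow> 'a set) \<Rightarrow> bool" where
  "powers_family a g E \<longleftrightarrow>
     (\<forall>j. g j \<in> carrier G) \<and> (\<forall>i j. i \<noteq> j \<longrightarrow> E i \<inter> E j = {}) \<and>
     (\<forall>j. \<forall>x\<in>carrier G. x \<notin> E j \<longrightarrow> g j \<otimes> a \<otimes> inv (g j) \<otimes> x \<in> E j)"

context hyperbolic_length
begin

text \<open>
  All elements \<open>g\<^sub>j\<^sup>-\<^sup>1 = t\<^sup>-\<^sup>1 s\<^sup>-\<^sup>n\<^sup>j\<close> start in the direction of \<open>t\<^sup>-\<^sup>1\<close>, which is avoided by \<open>b\<close> and
  \<open>b\<^sup>-\<^sup>1\<close>. The set \<open>E j\<close> consists of the \<open>x\<close> such that \<open>g\<^sub>j\<^sup>-\<^sup>1 x\<close> does not start in the direction of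
  \<open>g\<^sub>j\<^sup>-\<^sup>1\<close>, equivalently such that the path from \<open>\<one>\<close> to \<open>x\<close> passes near \<open>g\<^sub>j\<close>. If \<open>x\<close> lies outside
  \<open>E j\<close>, then \<open>y = g\<^sub>j\<^sup>-\<^sup>1 x\<close> starts in the direction of \<open>g\<^sub>j\<^sup>-\<^sup>1\<close>, so there is little cancellation in
  \<open>b y\<close>, which therefore starts in the direction of \<open>b\<close>; hence \<open>g\<^sub>j b y\<close> belongs to \<open>E j\<close>. The sets
  are disjoint since no \<open>g\<^sub>i\<close> lies near the path from \<open>\<one>\<close> to another \<open>g\<^sub>j\<close>. The powers of \<open>s\<close> enter as a
  homomorphism \<open>\<sigma>\<close> so that conjugates of powers can be inserted directly.
\<close>

lemma powers_family_of_direction: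
  fixes \<sigma> :: "int \<Rightarrow> 'a"
  assumes hom: "\<sigma> \<in> hom integer_group G"
    and t: "t \<in> carrier G" and b: "b \<in> carrier G" and \<beta>: "0 \<le> \<beta>"
    and st: "\<And>k. gromov \<one> t (\<sigma> k) \<le> \<beta>"
    and tb: "gromov \<one> (inv t) b \<le> \<beta> + \<delta>" "gromov \<one> (inv t) (inv b) \<le> \<beta> + \<delta>"
    and lt: "2 * \<beta> + 6 * \<delta> < len t" and lb: "2 * \<beta> + 6 * \<delta> < len b"
    and grow: "\<And>k. n \<le> \<bar>k\<bar> \<Longrightarrow> 2 * \<beta> + \<delta> < len (\<sigma> k)" and n: "1 \<le> n"
  shows "\<exists>g E. powers_family b g E"
proof -
  have \<sigma>: "\<sigma> k \<in> carrier G" for k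
    using hom by (auto simp: hom_def integer_group_def)
  have \<sigma>_add: "\<sigma> (i + j) = \<sigma> i \<otimes> \<sigma> j" for i j
    using hom by (auto simp: hom_def integer_group_def)
  have \<sigma>0: "\<sigma> 0 = \<one>" using \<sigma>_add[of 0 0] \<sigma>[of 0] by simp
  have \<sigma>_inv: "inv (\<sigma> k) = \<sigma> (- k)" for k
    using \<sigma>_add[of "- k" k] \<sigma> \<sigma>0 by (intro inv_equality) auto
  define g where "g j = \<sigma> (n * int j) \<otimes> t" for j
  have g: "g j \<in> carrier G" for j using \<sigma> t by (simp add: g_def)
  have g_inv: "inv (g j) = inv t \<otimes> \<sigma> (- (n * int j))" for j
    using \<sigma> t by (simp add: g_def inv_mult_group \<sigma>_inv)
  \<comment> \<open>One \<open>\<delta>\<close> is already in the hypothesis on \<open>inv t\<close>, one is lost in passing from \<open>inv t\<close> to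
    \<open>inv (g j)\<close>, and one in passing on to the translated point.\<close>
  define c where "c = \<beta> + 3 * \<delta>"
  define E where "E j = {x \<in> carrier G. gromov \<one> (inv (g j)) (inv (g j) \<otimes> x) \<le> c}" for j
  have start: "len t - \<beta> \<le> gromov \<one> (inv t) (inv (g j))" for j
    using gromov_flip[of t "\<sigma> (- (n * int j))"] st[of "- (n * int j)"] \<sigma> t by (simp add: g_inv)
  have gb: "gromov \<one> (inv (g j)) z \<le> \<beta> + 2 * \<delta>" if "z = b \<or> z = inv b" for j z
  proof -
    have "gromov \<one> (inv t) z \<le> \<beta> + \<delta>" using tb that by auto
    then show ?thesis
      using gromov_separate[of \<one> "inv t" "inv (g j)" z "\<beta> + \<delta>"] start[of j] lt \<beta> delta_nonneg t b g that
      by auto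
  qed
  have apart: "c + \<delta> < gromov \<one> (inv (g i)) (inv (g i) \<otimes> g j)" if ij: "i \<noteq> j" for i j
  proof (rule ccontr)
    assume "\<not> ?thesis"
    then have near: "gromov \<one> (inv (g i)) (inv (g i) \<otimes> g j) \<le> c + \<delta>" by simp
    define k where "k = n * (int j - int i)"
    have "n * 1 \<le> n * \<bar>int j - int i\<bar>" using ij n by (intro mult_left_mono) auto
    then have k: "n \<le> \<bar>k\<bar>" using n by (simp add: k_def abs_mult)
    have gij: "inv (g i) \<otimes> g j = inv t \<otimes> (\<sigma> k \<otimes> t)"
    proof -
      have "inv (g i) \<otimes> g j = inv t \<otimes> ((\<sigma> (- (n * int i)) \<otimes> \<sigma> (n * int j)) \<otimes> t)"
        unfolding g_inv g_def[of j] using \<sigma> t by (simp add: m_assoc)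
      also have "\<sigma> (- (n * int i)) \<otimes> \<sigma> (n * int j) = \<sigma> k"
        unfolding \<sigma>_add[symmetric] by (simp add: k_def algebra_simps)
      finally show ?thesis .
    qed
    have "gromov \<one> (\<sigma> k) (\<sigma> k \<otimes> t) = len (\<sigma> k) - gromov \<one> (\<sigma> (- k)) t"
      using gromov_flip[of "\<sigma> (- k)" t] \<sigma> t \<sigma>_inv[of "- k"] len_inv[OF \<sigma>[of "- k"]] by simp
    then have "\<beta> + \<delta> < gromov \<one> (\<sigma> k) (\<sigma> k \<otimes> t)"
      using grow[OF k] st[of "- k"] gromov_sym[of t "\<sigma> (- k)" \<one>] \<sigma> t by simp
    then have "gromov \<one> (\<sigma> k \<otimes> t) t \<le> \<beta> + \<delta>"
      using gromov_separate[of \<one> "\<sigma> k" "\<sigma> k \<otimes> t" t \<beta>] st[of k] gromov_sym[of t "\<sigma> k" \<one>] \<sigma> t by simp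
    moreover have "gromov \<one> (inv t) (inv t \<otimes> (\<sigma> k \<otimes> t)) = len t - gromov \<one> t (\<sigma> k \<otimes> t)"
      using \<sigma> t by (intro gromov_flip) auto
    ultimately have 1: "len t - \<beta> - \<delta> \<le> gromov \<one> (inv t) (inv (g i) \<otimes> g j)"
      using gromov_sym[of t "\<sigma> k \<otimes> t" \<one>] \<sigma> t by (simp add: gij)
    have "gromov \<one> (inv t) (inv (g i) \<otimes> g j) \<le> c + \<delta> + \<delta>"
      using gromov_separate[of \<one> "inv (g i)" "inv t" "inv (g i) \<otimes> g j" "c + \<delta>"] near start[of i] lt
        gromov_sym[of "inv t" "inv (g i)" \<one>] g t delta_nonneg by (simp add: c_def)
    then show False using 1 lt by (simp add: c_def)
  qed
  have disj: "E i \<inter> E j = {}" if ij: "i \<noteq> j" for i j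
  proof (rule ccontr)
    assume "E i \<inter> E j \<noteq> {}"
    then obtain x where x: "x \<in> carrier G" "gromov \<one> (inv (g i)) (inv (g i) \<otimes> x) \<le> c"
      "gromov \<one> (inv (g j)) (inv (g j) \<otimes> x) \<le> c"
      by (auto simp: E_def)
    have 1: "len (g i) - c \<le> gromov \<one> (g i) x" "len (g j) - c \<le> gromov \<one> (g j) x"
      using x g gromov_flip[of "g i" x] gromov_flip[of "g j" x] by auto
    have 2: "gromov \<one> (g i) (g j) + \<delta> < len (g i) - c" "gromov \<one> (g i) (g j) + \<delta> < len (g j) - c"
      using apart[OF ij] apart[OF ij[symmetric]] g gromov_flip[of "g i" "g j"] gromov_flip[of "g j" "g i"]
        gromov_sym[of "g i" "g j" \<one>] by auto
    have "gromov \<one> x (g j) \<le> gromov \<one> (g i) (g j) + \<delta>"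
      using gromov_separate[of \<one> "g i" x "g j" "gromov \<one> (g i) (g j)"] 1 2 g x by simp
    then show False using 1 2 gromov_sym[of x "g j" \<one>] g x by simp
  qed
  have flip: "g j \<otimes> b \<otimes> inv (g j) \<otimes> x \<in> E j" if x: "x \<in> carrier G" "x \<notin> E j" for j x
  proof -
    define y where "y = inv (g j) \<otimes> x"
    have y: "y \<in> carrier G" using x g by (simp add: y_def)
    have yc: "c < gromov \<one> (inv (g j)) y" using x by (simp add: E_def y_def)
    then have "gromov \<one> y (inv b) \<le> c"
      using gromov_separate[of \<one> "inv (g j)" y "inv b" "\<beta> + 2 * \<delta>"] gb[of "inv b" j] g b y
      by (simp add: c_def)
    then have "len b - c \<le> gromov \<one> b (b \<otimes> y)"
      using gromov_flip[of "inv b" y] gromov_sym[of y "inv b" \<one>] b y by (simp add: len_inv)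
    then have "gromov \<one> (b \<otimes> y) (inv (g j)) \<le> c"
      using gromov_separate[of \<one> b "b \<otimes> y" "inv (g j)" "\<beta> + 2 * \<delta>"] gb[of b j] lb g b y
        gromov_sym[of b "inv (g j)" \<one>] by (simp add: c_def)
    moreover have "inv (g j) \<otimes> (g j \<otimes> b \<otimes> inv (g j) \<otimes> x) = b \<otimes> y"
      using g b x by (simp add: y_def m_assoc) (simp add: m_assoc[symmetric])
    ultimately show ?thesis
      using gromov_sym[of "b \<otimes> y" "inv (g j)" \<one>] g b y x by (simp add: E_def)
  qed
  have "powers_family b g E"
    unfolding powers_family_def by (intro conjI allI ballI impI g disj flip)
  then show ?thesis by blast
qed

end

context quasi_axis
begin

text \<open>
  The directions \<open>P n\<close>, \<open>P (- n)\<close> and \<open>q n\<close> pairwise diverge, so each of \<open>b\<close> and \<open>b\<^sup>-\<^sup>1\<close> follows at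
  most one of them, and a direction \<open>v = t\<^sup>-\<^sup>1\<close> avoided by both is left over. The sequence of the other
  family of powers then diverges from \<open>t\<close>, as required for ping-pong.
\<close>

lemma powers_family_if_transverse:
  assumes x: "x \<in> carrier G" and B: "\<And>i j. gromov \<one> (x \<otimes> P i) (P j) \<le> B"
    and a: "a \<in> carrier G" "infinite (conjugacy_class G a)"
  shows "\<exists>g E. powers_family a g E"
proof -
  define q where "q k = x \<otimes> P k \<otimes> inv x" for k
  define \<beta> where "\<beta> = max (B + len x) C"
  have q: "q k \<in> carrier G" for k using x by (simp add: q_def)
  have \<beta>0: "0 \<le> \<beta>" using R_nonneg delta_nonneg by (simp add: \<beta>_def)
  have qp: "gromov \<one> (q k) (P l) \<le> \<beta>" for k l
  proof -
    have "len_dist (q k) (x \<otimes> P k) = len_dist ((x \<otimes> P k) \<otimes> inv x) ((x \<otimes> P k) \<otimes> \<one>)"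
      using x by (simp add: q_def del: len_dist_left)
    also have "\<dots> = len x"
      using x len_dist_sym[of "inv x" \<one>] by (subst len_dist_left) (simp_all add: len_inv)
    finally show ?thesis
      using gromov_move[of \<one> "q k" "x \<otimes> P k" "P l"] B[of k l] x q by (simp add: \<beta>_def)
  qed
  have pq: "gromov \<one> (P l) (q k) \<le> \<beta>" for k l
    using qp[of k l] gromov_sym[of "P l" "q k" \<one>] q by simp
  have len_q: "len (P k) - 2 * len x \<le> len (q k)" for k
  proof -
    have "P k = inv x \<otimes> q k \<otimes> x"
      using x by (simp add: q_def m_assoc) (simp add: m_assoc[symmetric])
    then show ?thesis
      using len_mult[of "inv x" "q k"] len_mult[of "inv x \<otimes> q k" x] x q len_inv[OF x] by simp
  qed
  define L where "L = 2 * \<beta> + 6 * \<delta>"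
  obtain n where n: "1 \<le> n" "\<And>k. n \<le> \<bar>k\<bar> \<Longrightarrow> L + 2 * len x < len (P k)"
    using len_P_unbounded by blast
  have lx: "0 \<le> len x" using x by (rule len_nonneg)
  have lP: "L < len (P k)" and lq: "L < len (q k)" if "n \<le> \<bar>k\<bar>" for k
    using n(2)[OF that] len_q[of k] lx by auto
  have "conjugacy_class G a \<subseteq> carrier G" using a by (auto simp: conjugacy_class_def)
  then obtain b where "b \<in> conjugacy_class G a" and lb: "L < len b"
    using unbounded_length a(2) by blast
  then obtain h where h: "h \<in> carrier G" "b = h \<otimes> a \<otimes> inv h"
    by (auto simp: conjugacy_class_def)
  have b: "b \<in> carrier G" using h a by simp
  have homP: "P \<in> hom integer_group G"
    by (auto simp: hom_def integer_group_def int_pow_mult)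
  have homq: "q \<in> hom integer_group G"
  proof -
    have "q (i + j) = q i \<otimes> q j" for i j
    proof -
      have "q i \<otimes> q j = x \<otimes> P i \<otimes> (inv x \<otimes> x) \<otimes> P j \<otimes> inv x"
        unfolding q_def using x by (simp only: m_assoc m_closed inv_closed int_pow_closed p_closed)
      then show ?thesis using x by (simp add: q_def int_pow_mult m_assoc)
    qed
    then show ?thesis using q by (auto simp: hom_def integer_group_def)
  qed
  have invP: "inv (P k) = P (- k)" for k by (simp add: int_pow_neg)
  have invq: "inv (q k) = q (- k)" for k
    using x by (simp add: q_def int_pow_neg inv_mult_group m_assoc)
  have block: "gromov \<one> v z \<le> \<beta> + \<delta> \<or> gromov \<one> v' z \<le> \<beta> + \<delta>"
    if "gromov \<one> v v' \<le> \<beta>" "v \<in> carrier G" "v' \<in> carrier G" "z \<in> carrier G" for v v' z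
    using gromov_separate[of \<one> v z v' \<beta>] that gromov_sym[of z v' \<one>] by force
  have pp: "gromov \<one> (P n) (P (- n)) \<le> \<beta>"
    using P_between[of "- n" 0 n] n(1) gromov_sym[of "P n" "P (- n)" \<one>] by (simp add: \<beta>_def)
  define free where "free v \<longleftrightarrow> gromov \<one> v b \<le> \<beta> + \<delta> \<and> gromov \<one> v (inv b) \<le> \<beta> + \<delta>" for v
  have "free (P n) \<or> free (P (- n)) \<or> free (q n)"
    using block[OF pp, of b] block[OF pp, of "inv b"] block[OF pq[of n n], of b]
      block[OF pq[of n n], of "inv b"] block[OF pq[of "- n" n], of b]
      block[OF pq[of "- n" n], of "inv b"] b q
    unfolding free_def by (metis int_pow_closed p_closed inv_closed)
  then obtain k v where k: "k = n \<or> k = - n" and v: "v = P k \<or> v = q k" and "free v" by blast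
  then have vb: "gromov \<one> v b \<le> \<beta> + \<delta>" "gromov \<one> v (inv b) \<le> \<beta> + \<delta>"
    by (simp_all add: free_def)
  have kn: "n \<le> \<bar>- k\<bar>" using k n(1) by auto
  have ex: "\<exists>g E. powers_family b g E"
  proof (cases "v = P k")
    case True
    show ?thesis
    proof (rule powers_family_of_direction[OF homq _ b \<beta>0, where t = "P (- k)" and n = n])
      show "gromov \<one> (inv P (- k)) b \<le> \<beta> + \<delta>" "gromov \<one> (inv P (- k)) (inv b) \<le> \<beta> + \<delta>"
        using vb True by (simp_all add: invP)
      show "2 * \<beta> + 6 * \<delta> < len (P (- k))" "2 * \<beta> + 6 * \<delta> < len b"
        using lP[OF kn] lb by (simp_all add: L_def)
      show "2 * \<beta> + \<delta> < len (q l)" if "n \<le> \<bar>l\<bar>" for l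
        using lq[OF that] delta_nonneg by (simp add: L_def)
    qed (rule int_pow_closed p_closed pq n(1))+
  next
    case False
    then have v: "v = q k" using v by simp
    show ?thesis
    proof (rule powers_family_of_direction[OF homP _ b \<beta>0, where t = "q (- k)" and n = n])
      show "gromov \<one> (inv q (- k)) b \<le> \<beta> + \<delta>" "gromov \<one> (inv q (- k)) (inv b) \<le> \<beta> + \<delta>"
        using vb v by (simp_all add: invq)
      show "2 * \<beta> + 6 * \<delta> < len (q (- k))" "2 * \<beta> + 6 * \<delta> < len b"
        using lq[OF kn] lb by (simp_all add: L_def)
      show "2 * \<beta> + \<delta> < len (P l)" if "n \<le> \<bar>l\<bar>" for l
        using lP[OF that] delta_nonneg by (simp add: L_def)
    qed (rule q qp n(1))+
  qed
  then obtain g E where gE: "powers_family b g E" by blast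
  then have g: "g j \<in> carrier G" for j by (simp add: powers_family_def)
  have e: "(g j \<otimes> h) \<otimes> a \<otimes> inv (g j \<otimes> h) = g j \<otimes> b \<otimes> inv (g j)" for j
    using g[of j] h a by (simp add: inv_mult_group m_assoc)
  have "powers_family a (\<lambda>j. g j \<otimes> h) E"
    using gE h(1) unfolding powers_family_def e by simp
  then show ?thesis by blast
qed

end

lemma (in hyperbolic_length) powers_family_if_not_elementary:
  assumes "\<not> elementary_group G" and a: "a \<in> carrier G" "infinite (conjugacy_class G a)"
  shows "\<exists>g E. powers_family a g E"
proof -
  have "conjugacy_class G a \<subseteq> carrier G" using a by (auto simp: conjugacy_class_def)
  then have "infinite (carrier G)" using a(2) finite_subset by blast
  then obtain p R where "quasi_axis G len \<delta> p R" using exists_quasi_axis by blast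
  then interpret quasi_axis G len \<delta> p R .
  show ?thesis using elementary_or_transverse[OF assms(1)] powers_family_if_transverse[OF _ _ a] by blast
qed

section \<open>Averages of conjugates in the reduced C*-algebra\<close>

lemma has_sum_finite_sum:
  fixes f :: "'i \<Rightarrow> 'x \<Rightarrow> real"
  assumes "finite J" "\<And>j. j \<in> J \<Longrightarrow> (f j has_sum s j) A"
  shows "((\<lambda>x. \<Sum>j\<in>J. f j x) has_sum (\<Sum>j\<in>J. s j)) A"
  using assms by (induction rule: finite_induct) (auto intro: has_sum_add has_sum_0)

lemma ell2_dominated:
  assumes "(F has_sum s) A" "\<And>x. x \<in> A \<Longrightarrow> (cmod (\<eta> x))\<^sup>2 \<le> F x" "\<And>x. x \<notin> A \<Longrightarrow> \<eta> x = 0"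
  shows "\<eta> \<in> ell2 A" "ell2_norm A \<eta> \<le> sqrt s"
proof -
  have F: "F summable_on A" "infsum F A = s" using assms(1) unfolding has_sum_iff by blast+
  have sm: "(\<lambda>x. (cmod (\<eta> x))\<^sup>2) summable_on A"
    by (rule summable_on_comparison_test[OF F(1) assms(2)]) simp_all
  then show "\<eta> \<in> ell2 A" using assms(3) by (simp add: ell2_def)
  show "ell2_norm A \<eta> \<le> sqrt s"
    unfolding ell2_norm_def F(2)[symmetric]
    by (intro real_sqrt_le_mono infsum_mono F(1) sm assms(2))
qed

lemma ell2_has_sum:
  assumes "\<xi> \<in> ell2 A"
  shows "((\<lambda>x. (cmod (\<xi> x))\<^sup>2) has_sum (ell2_norm A \<xi>)\<^sup>2) A"
  using assms by (auto simp: ell2_def ell2_norm_def infsum_nonneg)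

lemma zero_in_ell2: "(\<lambda>x. 0) \<in> ell2 A"
  by (simp add: ell2_def)

lemma ell2_norm_zero: "ell2_norm A (\<lambda>x. 0) = 0"
  by (simp add: ell2_norm_def)

lemma ell2_scale: "\<xi> \<in> ell2 A \<Longrightarrow> (\<lambda>x. c * \<xi> x) \<in> ell2 A"
  by (auto simp: ell2_def norm_mult power_mult_distrib intro: summable_on_cmult_right)

lemma square_add_le: "(a + b)\<^sup>2 \<le> 2 * a\<^sup>2 + 2 * (b::real)\<^sup>2"
  using sum_squares_bound[of a b] by (simp add: power2_sum)

lemma ell2_add:
  assumes "\<xi> \<in> ell2 A" "\<eta> \<in> ell2 A"
  shows "(\<lambda>x. \<xi> x + \<eta> x) \<in> ell2 A"
proof (rule ell2_dominated(1))
  show "((\<lambda>x. 2 * (cmod (\<xi> x))\<^sup>2 + 2 * (cmod (\<eta> x))\<^sup>2) has_sum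
      (2 * (ell2_norm A \<xi>)\<^sup>2 + 2 * (ell2_norm A \<eta>)\<^sup>2)) A"
    by (intro has_sum_add has_sum_cmult_right ell2_has_sum assms)
  show "(cmod (\<xi> x + \<eta> x))\<^sup>2 \<le> 2 * (cmod (\<xi> x))\<^sup>2 + 2 * (cmod (\<eta> x))\<^sup>2" for x
    by (rule order_trans[OF power_mono[OF norm_triangle_ineq] square_add_le]) simp
qed (use assms in \<open>auto simp: ell2_def\<close>)

context group
begin

text \<open>
  The image of an element of the group ring, with a family indexed by natural numbers in place of a
  coefficient function: the elements \<open>h j\<close> may coincide, which is convenient for averages.
\<close>

definition rep_sum :: "nat set \<Rightarrow> (nat \<Rightarrow> complex) \<Rightarrow> (nat \<Rightarrow> 'a) \<Rightarrow> 'a operator" where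
  "rep_sum J c h = (\<lambda>\<xi> x. \<Sum>j\<in>J. c j * regular_rep G (h j) \<xi> x)"

lemma translate_has_sum:
  assumes g: "g \<in> carrier G"
  shows "((\<lambda>x. f (inv g \<otimes> x)) has_sum s) (carrier G) \<longleftrightarrow> (f has_sum s) (carrier G)"
proof (rule has_sum_reindex_bij_betw)
  show "bij_betw (\<lambda>x. inv g \<otimes> x) (carrier G) (carrier G)"
    by (rule bij_betw_byWitness[where f' = "\<lambda>x. g \<otimes> x"]) (use g in \<open>auto simp: m_assoc[symmetric]\<close>)
qed

lemma regular_rep_has_sum:
  assumes g: "g \<in> carrier G" and \<xi>: "\<xi> \<in> ell2 (carrier G)"
  shows "((\<lambda>x. (cmod (regular_rep G g \<xi> x))\<^sup>2) has_sum (ell2_norm (carrier G) \<xi>)\<^sup>2) (carrier G)"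
proof -
  have "((\<lambda>x. (cmod (\<xi> (inv g \<otimes> x)))\<^sup>2) has_sum (ell2_norm (carrier G) \<xi>)\<^sup>2) (carrier G)"
    using translate_has_sum[OF g, of "\<lambda>x. (cmod (\<xi> x))\<^sup>2"] ell2_has_sum[OF \<xi>] by simp
  then show ?thesis
    by (rule has_sum_cong[THEN iffD1, rotated]) (simp add: regular_rep_def \<xi>)
qed

lemma regular_rep_in_ell2:
  assumes "g \<in> carrier G" "\<xi> \<in> ell2 (carrier G)"
  shows "regular_rep G g \<xi> \<in> ell2 (carrier G)"
  by (rule ell2_dominated(1)[OF regular_rep_has_sum[OF assms]]) (simp_all add: regular_rep_def)

lemma regular_rep_comp:
  assumes g: "g \<in> carrier G" and h: "h \<in> carrier G"
  shows "regular_rep G g \<circ> regular_rep G h = regular_rep G (g \<otimes> h)"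
proof
  fix \<xi>
  show "(regular_rep G g \<circ> regular_rep G h) \<xi> = regular_rep G (g \<otimes> h) \<xi>"
  proof (cases "\<xi> \<in> ell2 (carrier G)")
    case True
    then show ?thesis
      using regular_rep_in_ell2[OF h True] g h
      by (auto simp: regular_rep_def[of G g] regular_rep_def[of G h] regular_rep_def[of G "g \<otimes> h"] inv_mult_group m_assoc)
  next
    case False
    then show ?thesis by (auto simp: regular_rep_def)
  qed
qed

lemma rep_sum_bounded:
  assumes J: "finite J" and h: "\<And>j. j \<in> J \<Longrightarrow> h j \<in> carrier G"
  shows "rep_sum J c h \<in> bounded_operators (carrier G)"
proof -
  let ?A = "carrier G"
  define K where "K = (\<Sum>j\<in>J. (cmod (c j))\<^sup>2) * card J"
  have K: "0 \<le> K" by (simp add: K_def sum_nonneg)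
  have main: "rep_sum J c h \<xi> \<in> ell2 ?A" "ell2_norm ?A (rep_sum J c h \<xi>) \<le> sqrt K * ell2_norm ?A \<xi>"
    if \<xi>: "\<xi> \<in> ell2 ?A" for \<xi>
  proof -
    define F where "F x = (\<Sum>j\<in>J. (cmod (c j))\<^sup>2 * (cmod (regular_rep G (h j) \<xi> x))\<^sup>2) * card J" for x
    have "(F has_sum (\<Sum>j\<in>J. (cmod (c j))\<^sup>2 * (ell2_norm ?A \<xi>)\<^sup>2) * card J) ?A"
      unfolding F_def
      by (intro has_sum_cmult_left has_sum_finite_sum J has_sum_cmult_right regular_rep_has_sum h \<xi>)
    then have F: "(F has_sum K * (ell2_norm ?A \<xi>)\<^sup>2) ?A"
      by (simp add: K_def sum_distrib_right[symmetric] mult_ac)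
    have le: "(cmod (rep_sum J c h \<xi> x))\<^sup>2 \<le> F x" for x
    proof -
      have "cmod (rep_sum J c h \<xi> x) \<le> (\<Sum>j\<in>J. cmod (c j) * cmod (regular_rep G (h j) \<xi> x))"
        unfolding rep_sum_def by (rule order_trans[OF norm_sum]) (simp add: norm_mult)
      then have "(cmod (rep_sum J c h \<xi> x))\<^sup>2 \<le> (\<Sum>j\<in>J. cmod (c j) * cmod (regular_rep G (h j) \<xi> x))\<^sup>2"
        by (rule power_mono) simp
      also have "\<dots> \<le> F x"
        unfolding F_def power_mult_distrib[symmetric] by (rule sum_squared_le_sum_of_squares)
      finally show ?thesis .
    qed
    have off: "rep_sum J c h \<xi> x = 0" if "x \<notin> ?A" for x
      using that by (simp add: rep_sum_def regular_rep_def)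
    show "rep_sum J c h \<xi> \<in> ell2 ?A" by (rule ell2_dominated(1)[OF F le off])
    have "0 \<le> ell2_norm ?A \<xi>" by (simp add: ell2_norm_def infsum_nonneg)
    then show "ell2_norm ?A (rep_sum J c h \<xi>) \<le> sqrt K * ell2_norm ?A \<xi>"
      using ell2_dominated(2)[OF F le off] by (simp add: real_sqrt_mult)
  qed
  have add: "rep_sum J c h (\<lambda>x. \<xi> x + \<eta> x) = (\<lambda>x. rep_sum J c h \<xi> x + rep_sum J c h \<eta> x)"
    if "\<xi> \<in> ell2 ?A" "\<eta> \<in> ell2 ?A" for \<xi> \<eta>
    using that ell2_add[OF that]
    by (auto simp: rep_sum_def regular_rep_def sum.distrib[symmetric] distrib_left intro!: sum.cong)
  have scale: "rep_sum J c h (\<lambda>x. d * \<xi> x) = (\<lambda>x. d * rep_sum J c h \<xi> x)"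
    if "\<xi> \<in> ell2 ?A" for \<xi> d
    using that ell2_scale[OF that]
    by (auto simp: rep_sum_def regular_rep_def sum_distrib_left intro!: sum.cong)
  have off: "rep_sum J c h \<xi> = (\<lambda>x. 0)" if "\<xi> \<notin> ell2 ?A" for \<xi>
    using that by (simp add: rep_sum_def regular_rep_def)
  show ?thesis
    unfolding bounded_operators_def
    by (intro CollectI conjI ballI allI impI exI[of _ "sqrt K"] main off add scale)
qed

lemma rep_sum_eq_group_ring_rep:
  assumes J: "finite J" and h: "\<And>j. j \<in> J \<Longrightarrow> h j \<in> carrier G"
  shows "\<exists>f\<in>group_ring G. group_ring_rep G f = rep_sum J c h"
proof -
  define f where "f g = (\<Sum>j\<in>J. if h j = g then c j else 0)" for g
  have supp: "{g. f g \<noteq> 0} \<subseteq> h ` J"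
  proof
    fix g assume "g \<in> {g. f g \<noteq> 0}"
    then have "(\<Sum>j\<in>J. if h j = g then c j else 0) \<noteq> 0" by (simp add: f_def)
    then obtain j where "j \<in> J" "(if h j = g then c j else 0) \<noteq> 0" by (rule sum.not_neutral_contains_not_neutral)
    then show "g \<in> h ` J" by (cases "h j = g") auto
  qed
  have "h ` J \<subseteq> carrier G" using h by blast
  then have "f \<in> group_ring G"
    using finite_surj[OF J supp] supp by (simp add: group_ring_def)
  have eq: "group_ring_rep G f \<xi> x = rep_sum J c h \<xi> x" for \<xi> x
  proof -
    have "group_ring_rep G f \<xi> x = (\<Sum>g\<in>h ` J. f g * regular_rep G g \<xi> x)"
      unfolding group_ring_rep_def by (rule sum.mono_neutral_left) (use J supp in simp_all)
    also have "\<dots> = (\<Sum>j\<in>J. \<Sum>g\<in>h ` J. (if h j = g then c j * regular_rep G g \<xi> x else 0))"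
      unfolding f_def sum_distrib_right by (subst sum.swap) (simp add: if_distrib[of "\<lambda>z. z * _"] cong: if_cong)
    also have "\<dots> = (\<Sum>j\<in>J. c j * regular_rep G (h j) \<xi> x)"
      using J by (intro sum.cong refl) (simp add: sum.delta)
    finally show ?thesis by (simp add: rep_sum_def)
  qed
  have "group_ring_rep G f = rep_sum J c h" by (intro ext eq)
  with \<open>f \<in> group_ring G\<close> show ?thesis by blast
qed

lemma rep_sum_in_reduced_cstar:
  assumes J: "finite J" and h: "\<And>j. j \<in> J \<Longrightarrow> h j \<in> carrier G"
  shows "rep_sum J c h \<in> reduced_cstar G"
proof -
  obtain f where f: "f \<in> group_ring G" "group_ring_rep G f = rep_sum J c h"
    using rep_sum_eq_group_ring_rep[of J h c] J h by blast
  have "op_norm (carrier G) (op_diff (rep_sum J c h) (group_ring_rep G f)) = 0"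
  proof -
    have "{\<xi> \<in> ell2 (carrier G). ell2_norm (carrier G) \<xi> \<le> 1} \<noteq> {}"
      using zero_in_ell2[of "carrier G"] ell2_norm_zero[of "carrier G"] by (metis (mono_tags, lifting) empty_iff mem_Collect_eq zero_le_one)
    then show ?thesis
      by (simp add: f op_norm_def op_diff_def ell2_norm_zero)
  qed
  then show ?thesis
    using f(1) rep_sum_bounded[of J h c] J h by (auto simp: reduced_cstar_def intro!: bexI[of _ f])
qed

lemma regular_rep_eq_rep_sum: "regular_rep G g = rep_sum {0} (\<lambda>_. 1) (\<lambda>_. g)"
  by (simp add: rep_sum_def)

lemma regular_rep_in_reduced_cstar: "g \<in> carrier G \<Longrightarrow> regular_rep G g \<in> reduced_cstar G"
  unfolding regular_rep_eq_rep_sum by (rule rep_sum_in_reduced_cstar) auto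

lemma trace_rep_sum:
  assumes \<tau>: "cstar_trace G \<tau>" and J: "finite J" and h: "\<And>j. j \<in> J \<Longrightarrow> h j \<in> carrier G"
  shows "\<tau> (rep_sum J c h) = (\<Sum>j\<in>J. c j * \<tau> (regular_rep G (h j)))"
  using J h
proof (induction J rule: finite_induct)
  case empty
  have "rep_sum {} c h = op_scale 0 (regular_rep G \<one>)"
    by (simp add: rep_sum_def op_scale_def)
  then show ?case
    using \<tau> regular_rep_in_reduced_cstar[of \<one>] by (simp add: cstar_trace_def)
next
  case (insert i J)
  have 1: "rep_sum (insert i J) c h = op_add (op_scale (c i) (regular_rep G (h i))) (rep_sum J c h)"
    using insert by (simp add: rep_sum_def op_add_def op_scale_def)
  have "op_scale (c i) (regular_rep G (h i)) = rep_sum {0} (\<lambda>_. c i) (\<lambda>_. h i)"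
    by (simp add: rep_sum_def op_scale_def)
  then have "op_scale (c i) (regular_rep G (h i)) \<in> reduced_cstar G"
    using insert.prems rep_sum_in_reduced_cstar[of "{0}" "\<lambda>_. h i" "\<lambda>_. c i"] by simp
  moreover have "rep_sum J c h \<in> reduced_cstar G"
    using insert by (intro rep_sum_in_reduced_cstar) auto
  ultimately show ?case
    using \<tau> insert regular_rep_in_reduced_cstar[of "h i"] unfolding 1 by (simp add: cstar_trace_def)
qed

lemma trace_conjugate:
  assumes \<tau>: "cstar_trace G \<tau>" and g: "g \<in> carrier G" and a: "a \<in> carrier G"
  shows "\<tau> (regular_rep G (g \<otimes> a \<otimes> inv g)) = \<tau> (regular_rep G a)"
proof -
  have "\<tau> (regular_rep G g \<circ> regular_rep G (a \<otimes> inv g)) = \<tau> (regular_rep G (a \<otimes> inv g) \<circ> regular_rep G g)"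
    using \<tau> regular_rep_in_reduced_cstar g a by (simp add: cstar_trace_def)
  then show ?thesis
    using g a by (simp add: regular_rep_comp m_assoc)
qed

text \<open>
  At most one index has \<open>x \<in> E j\<close>, and its term is bounded by the first sum on the right without a
  factor \<open>N\<close> from the Cauchy-Schwarz inequality. For every other index \<open>h\<^sub>j\<^sup>-\<^sup>1 x\<close> lies in \<open>E j\<close>, since otherwise
  \<open>h\<^sub>j\<close> would move it into \<open>E j\<close>; there the factor \<open>N\<close> is affordable because the sets \<open>E j\<close> are disjoint.
\<close>

lemma powers_average_pointwise:
  assumes fam: "powers_family a g E" and a: "a \<in> carrier G" and x: "x \<in> carrier G"
    and u: "\<And>y. 0 \<le> u y"
  defines "h \<equiv> \<lambda>j. g j \<otimes> a \<otimes> inv (g j)"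
  shows "(\<Sum>j<N. u (inv (h j) \<otimes> x))\<^sup>2 \<le>
    2 * (\<Sum>j<N. (u (inv (h j) \<otimes> x))\<^sup>2) +
    2 * real N * (\<Sum>j<N. of_bool (inv (h j) \<otimes> x \<in> E j) * (u (inv (h j) \<otimes> x))\<^sup>2)"
proof -
  define v where "v j = u (inv (h j) \<otimes> x)" for j
  define S where "S = {j. j < N \<and> x \<in> E j}"
  have hG: "h j \<in> carrier G" for j using fam a by (simp add: h_def powers_family_def)
  have disj: "E i \<inter> E j = {}" if "i \<noteq> j" for i j using fam that by (simp add: powers_family_def)
  have S: "finite S" "S \<subseteq> {..<N}" by (auto simp: S_def)
  have "card S \<le> 1" unfolding One_nat_def card_le_Suc0_iff_eq[OF S(1)] using disj by (auto simp: S_def)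
  have mem: "inv (h j) \<otimes> x \<in> E j" if "j \<in> {..<N} - S" for j
  proof (rule ccontr)
    assume "inv (h j) \<otimes> x \<notin> E j"
    then have "h j \<otimes> (inv (h j) \<otimes> x) \<in> E j"
      using fam hG[of j] x unfolding powers_family_def h_def by blast
    moreover have "h j \<otimes> (inv (h j) \<otimes> x) = x"
      using hG[of j] x by (simp add: m_assoc[symmetric])
    ultimately show False using that by (auto simp: S_def)
  qed
  have "(\<Sum>j\<in>S. v j)\<^sup>2 \<le> (\<Sum>j\<in>S. (v j)\<^sup>2) * card S" by (rule sum_squared_le_sum_of_squares)
  also have "\<dots> \<le> (\<Sum>j\<in>S. (v j)\<^sup>2) * 1" using \<open>card S \<le> 1\<close> by (intro mult_left_mono sum_nonneg) auto
  also have "\<dots> \<le> (\<Sum>j<N. (v j)\<^sup>2)" using S by (simp add: sum_mono2)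
  finally have A: "(\<Sum>j\<in>S. v j)\<^sup>2 \<le> (\<Sum>j<N. (v j)\<^sup>2)" .
  have "(\<Sum>j\<in>{..<N} - S. v j)\<^sup>2 \<le> (\<Sum>j\<in>{..<N} - S. (v j)\<^sup>2) * card ({..<N} - S)"
    by (rule sum_squared_le_sum_of_squares)
  also have "\<dots> \<le> (\<Sum>j\<in>{..<N} - S. (v j)\<^sup>2) * N"
    using card_mono[of "{..<N}" "{..<N} - S"] by (intro mult_left_mono sum_nonneg) auto
  also have "(\<Sum>j\<in>{..<N} - S. (v j)\<^sup>2) = (\<Sum>j\<in>{..<N} - S. of_bool (inv (h j) \<otimes> x \<in> E j) * (v j)\<^sup>2)"
    using mem by (intro sum.cong) auto
  also have "\<dots> \<le> (\<Sum>j<N. of_bool (inv (h j) \<otimes> x \<in> E j) * (v j)\<^sup>2)"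
    by (intro sum_mono2) auto
  finally have B: "(\<Sum>j\<in>{..<N} - S. v j)\<^sup>2 \<le> (\<Sum>j<N. of_bool (inv (h j) \<otimes> x \<in> E j) * (v j)\<^sup>2) * N"
    by (simp add: mult_right_mono)
  have "(\<Sum>j<N. v j) = (\<Sum>j\<in>{..<N} - S. v j) + (\<Sum>j\<in>S. v j)"
    using S by (intro sum.subset_diff) auto
  then have "(\<Sum>j<N. v j)\<^sup>2 \<le> 2 * (\<Sum>j\<in>{..<N} - S. v j)\<^sup>2 + 2 * (\<Sum>j\<in>S. v j)\<^sup>2"
    by (simp add: square_add_le)
  then show ?thesis using A B by (simp add: v_def algebra_simps)
qed

text \<open>
  Summing the pointwise estimate over the group: translation invariance bounds the first part by
  \<open>2 N \<parallel>\<xi>\<parallel>\<^sup>2\<close>, and disjointness of the sets \<open>E j\<close> bounds the second by the same number. Dividing by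
  \<open>N\<^sup>2\<close> leaves \<open>4 / N\<close>.
\<close>

lemma powers_average_norm:
  assumes fam: "powers_family a g E" and a: "a \<in> carrier G" and N: "0 < N"
  defines "h \<equiv> \<lambda>j. g j \<otimes> a \<otimes> inv (g j)"
  shows "op_norm (carrier G) (rep_sum {..<N} (\<lambda>_. 1 / of_nat N) h) \<in> {0..2 / sqrt N}"
proof -
  let ?A = "carrier G"
  define T where "T = rep_sum {..<N} (\<lambda>_. 1 / of_nat N) h"
  have hG: "h j \<in> ?A" for j using fam a by (simp add: h_def powers_family_def)
  have disj: "E i \<inter> E j = {}" if "i \<noteq> j" for i j using fam that by (simp add: powers_family_def)
  have "ell2_norm ?A (T \<xi>) \<le> 2 / sqrt N" if \<xi>: "\<xi> \<in> ell2 ?A" and \<xi>1: "ell2_norm ?A \<xi> \<le> 1" for \<xi>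
  proof -
    define u where "u y = cmod (\<xi> y)" for y
    define s where "s = (ell2_norm ?A \<xi>)\<^sup>2"
    have us: "((\<lambda>x. (u x)\<^sup>2) has_sum s) ?A"
      unfolding u_def s_def by (rule ell2_has_sum[OF \<xi>])
    have s: "s \<le> 1"
      unfolding s_def using \<xi>1 by (intro power_le_one) (simp_all add: ell2_norm_def infsum_nonneg)
    define r where "r j = infsum (\<lambda>y. of_bool (y \<in> E j) * (u y)\<^sup>2) ?A" for j
    have r: "((\<lambda>y. of_bool (y \<in> E j) * (u y)\<^sup>2) has_sum r j) ?A" for j
      unfolding r_def
      by (rule has_sum_infsum, rule summable_on_comparison_test[of "\<lambda>x. (u x)\<^sup>2"])
        (use us in \<open>auto simp: has_sum_iff\<close>)
    have rs: "(\<Sum>j<N. r j) \<le> s"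
    proof (rule has_sum_mono[OF has_sum_finite_sum[OF _ r] us])
      fix y
      define S where "S = {j. j < N \<and> y \<in> E j}"
      have S: "finite S" by (simp add: S_def)
      have "card S \<le> 1" unfolding One_nat_def card_le_Suc0_iff_eq[OF S] using disj by (auto simp: S_def)
      have "(\<Sum>j<N. of_bool (y \<in> E j) * (u y)\<^sup>2) = (\<Sum>j<N. of_bool (y \<in> E j)) * (u y)\<^sup>2"
        by (simp add: sum_distrib_right)
      also have "(\<Sum>j<N. of_bool (y \<in> E j)) = real (card S)"
        by (simp add: S_def of_bool_def sum.If_cases Int_def)
      also have "\<dots> * (u y)\<^sup>2 \<le> 1 * (u y)\<^sup>2" using \<open>card S \<le> 1\<close> by (intro mult_right_mono) auto
      finally show "(\<Sum>j<N. of_bool (y \<in> E j) * (u y)\<^sup>2) \<le> (u y)\<^sup>2" by simp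
    qed simp
    define F where "F x = (2 * (\<Sum>j<N. (u (inv (h j) \<otimes> x))\<^sup>2) +
      2 * real N * (\<Sum>j<N. of_bool (inv (h j) \<otimes> x \<in> E j) * (u (inv (h j) \<otimes> x))\<^sup>2)) / (real N)\<^sup>2" for x
    have "((\<lambda>x. (u (inv (h j) \<otimes> x))\<^sup>2) has_sum s) ?A" for j
      using translate_has_sum[OF hG, of "\<lambda>x. (u x)\<^sup>2"] us by simp
    moreover have "((\<lambda>x. of_bool (inv (h j) \<otimes> x \<in> E j) * (u (inv (h j) \<otimes> x))\<^sup>2) has_sum r j) ?A" for j
      using translate_has_sum[OF hG, of "\<lambda>y. of_bool (y \<in> E j) * (u y)\<^sup>2"] r by simp
    ultimately have F: "(F has_sum (2 * (\<Sum>j<N. s) + 2 * real N * (\<Sum>j<N. r j)) / (real N)\<^sup>2) ?A"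
      unfolding F_def divide_inverse
      by (intro has_sum_cmult_left has_sum_add has_sum_cmult_right has_sum_finite_sum) auto
    have le: "(cmod (T \<xi> x))\<^sup>2 \<le> F x" if x: "x \<in> ?A" for x
    proof -
      have "T \<xi> x = (\<Sum>j<N. \<xi> (inv (h j) \<otimes> x)) / of_nat N"
        using \<xi> x by (simp add: T_def rep_sum_def regular_rep_def sum_divide_distrib)
      then have "cmod (T \<xi> x) \<le> (\<Sum>j<N. u (inv (h j) \<otimes> x)) / N"
        unfolding u_def by (simp add: norm_divide divide_right_mono norm_sum)
      then have "(cmod (T \<xi> x))\<^sup>2 \<le> ((\<Sum>j<N. u (inv (h j) \<otimes> x)) / N)\<^sup>2"
        by (rule power_mono) simp
      also have "\<dots> \<le> F x"
        unfolding F_def power_divide h_def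
        by (intro divide_right_mono powers_average_pointwise[OF fam a x]) (simp_all add: u_def)
      finally show ?thesis .
    qed
    have "ell2_norm ?A (T \<xi>) \<le> sqrt ((2 * (\<Sum>j<N. s) + 2 * real N * (\<Sum>j<N. r j)) / (real N)\<^sup>2)"
      by (rule ell2_dominated(2)[OF F le]) (simp_all add: T_def rep_sum_def regular_rep_def)
    also have "\<dots> \<le> sqrt (4 / N)"
    proof (rule real_sqrt_le_mono)
      have "real N * s \<le> real N * 1" "real N * (\<Sum>j<N. r j) \<le> real N * 1"
        using s rs by (intro mult_left_mono; simp)+
      then have "(2 * (\<Sum>j<N. s) + 2 * real N * (\<Sum>j<N. r j)) / (real N)\<^sup>2 \<le> (4 * N) / (real N)\<^sup>2"
        by (intro divide_right_mono) auto
      also have "\<dots> = 4 / N" by (simp add: power2_eq_square)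
      finally show "(2 * (\<Sum>j<N. s) + 2 * real N * (\<Sum>j<N. r j)) / (real N)\<^sup>2 \<le> 4 / N" .
    qed
    also have "\<dots> = 2 / sqrt N" by (simp add: real_sqrt_divide)
    finally show ?thesis .
  qed
  then have bound: "\<And>\<xi>. \<xi> \<in> {\<xi> \<in> ell2 ?A. ell2_norm ?A \<xi> \<le> 1} \<Longrightarrow> ell2_norm ?A (T \<xi>) \<le> 2 / sqrt N"
    by simp
  have zero: "(\<lambda>x. 0) \<in> {\<xi> \<in> ell2 ?A. ell2_norm ?A \<xi> \<le> 1}"
    by (simp add: zero_in_ell2 ell2_norm_zero)
  have "op_norm ?A T \<le> 2 / sqrt N"
    unfolding op_norm_def using zero bound by (intro cSUP_least) auto
  moreover have "0 \<le> ell2_norm ?A (T (\<lambda>x. 0))" by (simp add: ell2_norm_def infsum_nonneg)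
  moreover have "ell2_norm ?A (T (\<lambda>x. 0)) \<le> op_norm ?A T"
    unfolding op_norm_def by (rule cSUP_upper[OF zero bdd_aboveI2[OF bound]])
  ultimately show ?thesis by (simp add: T_def)
qed

theorem trace_vanishes_of_powers_family:
  assumes \<tau>: "cstar_trace G \<tau>" and a: "a \<in> carrier G" and fam: "powers_family a g E"
  shows "\<tau> (regular_rep G a) = 0"
proof -
  obtain K where K: "\<And>x. x \<in> reduced_cstar G \<Longrightarrow> cmod (\<tau> x) \<le> K * op_norm (carrier G) x"
    using \<tau> unfolding cstar_trace_def by blast
  define h where "h j = g j \<otimes> a \<otimes> inv (g j)" for j
  have g: "g j \<in> carrier G" for j using fam by (simp add: powers_family_def)
  then have hG: "h j \<in> carrier G" for j using a by (simp add: h_def)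
  have bound: "cmod (\<tau> (regular_rep G a)) \<le> \<bar>K\<bar> * (2 / sqrt N)" if N: "0 < N" for N :: nat
  proof -
    define T where "T = rep_sum {..<N} (\<lambda>_. 1 / of_nat N) h"
    have T: "T \<in> reduced_cstar G" unfolding T_def by (rule rep_sum_in_reduced_cstar) (auto simp: hG)
    have "\<tau> T = (\<Sum>j<N. 1 / of_nat N * \<tau> (regular_rep G (h j)))"
      unfolding T_def by (rule trace_rep_sum[OF \<tau>]) (auto simp: hG)
    also have "\<dots> = \<tau> (regular_rep G a)"
      using N by (simp add: h_def trace_conjugate[OF \<tau> g a])
    finally have "cmod (\<tau> (regular_rep G a)) \<le> K * op_norm (carrier G) T" using K[OF T] by simp
    moreover have "op_norm (carrier G) T \<in> {0..2 / sqrt N}"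
      using powers_average_norm[OF fam a N] by (simp add: T_def h_def[abs_def])
    then have "K * op_norm (carrier G) T \<le> \<bar>K\<bar> * (2 / sqrt N)"
      by (intro mult_mono) auto
    ultimately show ?thesis by linarith
  qed
  have "(\<lambda>N. \<bar>K\<bar> * (2 / sqrt (real N))) \<longlonglongrightarrow> 0"
    by (intro tendsto_mult_right_zero tendsto_divide_0[OF tendsto_const] filterlim_at_top_imp_at_infinity
        filterlim_compose[OF sqrt_at_top filterlim_real_sequentially])
  then have "cmod (\<tau> (regular_rep G a)) \<le> 0"
    by (rule tendsto_lowerbound) (use bound in \<open>auto intro: eventually_sequentiallyI[of 1]\<close>)
  then show ?thesis by simp
qed

end

section \<open>Word metric and geodesics of the Cayley graph\<close>

locale cayley = group G for G (structure) +
  fixes S :: "'a set"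
  assumes finite_S: "finite S" and S_closed: "S \<subseteq> carrier G" and generates: "generate G S = carrier G"
begin

abbreviation "edges \<equiv> cayley_edges G S"

abbreviation "vd \<equiv> vertex_dist G S"

lemma edges_closed: "(u, v) \<in> edges \<Longrightarrow> u \<in> carrier G \<and> v \<in> carrier G"
  by (simp add: cayley_edges_def)

lemma edges_sym: "(u, v) \<in> edges \<Longrightarrow> (v, u) \<in> edges"
  by (auto simp: cayley_edges_def)

lemma edges_left:
  assumes g: "g \<in> carrier G" and e: "(u, v) \<in> edges"
  shows "(g \<otimes> u, g \<otimes> v) \<in> edges"
proof -
  have uv: "u \<in> carrier G" "v \<in> carrier G" "u \<noteq> v" using e by (auto simp: cayley_edges_def)
  obtain s where s: "s \<in> S" "v = u \<otimes> s \<or> u = v \<otimes> s"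
    using e unfolding cayley_edges_def by blast
  have sG: "s \<in> carrier G" using s S_closed by blast
  have "g \<otimes> v = g \<otimes> u \<otimes> s \<or> g \<otimes> u = g \<otimes> v \<otimes> s"
    using s(2) sG uv(1,2) g by (metis m_assoc)
  then show ?thesis
    using s(1) uv g unfolding cayley_edges_def by auto
qed

lemma walk_sym: "(u, v) \<in> edges ^^ n \<Longrightarrow> (v, u) \<in> edges ^^ n"
proof (induction n arbitrary: v)
  case (Suc n)
  then obtain w where "(u, w) \<in> edges ^^ n" "(w, v) \<in> edges" by auto
  then show ?case using Suc.IH relpow_Suc_I2 edges_sym by fast
qed auto

lemma walk_left:
  assumes g: "g \<in> carrier G"
  shows "(u, v) \<in> edges ^^ n \<Longrightarrow> (g \<otimes> u, g \<otimes> v) \<in> edges ^^ n"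
proof (induction n arbitrary: v)
  case (Suc n)
  then obtain w where "(u, w) \<in> edges ^^ n" "(w, v) \<in> edges" by auto
  then show ?case using Suc.IH edges_left[OF g] relpow_Suc_I by fast
qed auto

lemma walk_trans: "(u, v) \<in> edges ^^ m \<Longrightarrow> (v, w) \<in> edges ^^ n \<Longrightarrow> (u, w) \<in> edges ^^ (m + n)"
  by (auto simp: relpow_add)

lemma walk_generator:
  assumes s: "s \<in> S"
  shows "\<exists>n. (\<one>, s) \<in> edges ^^ n" "\<exists>n. (\<one>, inv s) \<in> edges ^^ n"
proof -
  have sG: "s \<in> carrier G" using s S_closed by blast
  have 1: "\<exists>n. (\<one>, s) \<in> edges ^^ n"
  proof (cases "s = \<one>")
    case True
    then show ?thesis by (intro exI[of _ 0]) simp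
  next
    case False
    then have "(\<one>, s) \<in> edges"
      using s sG unfolding cayley_edges_def by force
    then show ?thesis by (intro exI[of _ 1]) simp
  qed
  then obtain n where "(\<one>, s) \<in> edges ^^ n" by blast
  then have "(inv s \<otimes> s, inv s \<otimes> \<one>) \<in> edges ^^ n"
    using walk_left[OF inv_closed[OF sG]] walk_sym by blast
  then show "\<exists>n. (\<one>, inv s) \<in> edges ^^ n" using sG by auto
  show "\<exists>n. (\<one>, s) \<in> edges ^^ n" by fact
qed

lemma walk_from_one:
  assumes "x \<in> carrier G"
  shows "\<exists>n. (\<one>, x) \<in> edges ^^ n"
proof -
  have "x \<in> generate G S" using assms generates by simp
  then show ?thesis
  proof (induction rule: generate.induct)
    case one
    show ?case by (intro exI[of _ 0]) simp
  next
    case (incl h)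
    then show ?case by (rule walk_generator)
  next
    case (inv h)
    then show ?case by (rule walk_generator)
  next
    case (eng h1 h2)
    have "h1 \<in> carrier G" using eng.hyps generates by simp
    obtain m n where "(\<one>, h1) \<in> edges ^^ m" "(\<one>, h2) \<in> edges ^^ n" using eng.IH by blast
    then have "(\<one>, h1) \<in> edges ^^ m" "(h1, h1 \<otimes> h2) \<in> edges ^^ n"
      using walk_left[OF \<open>h1 \<in> carrier G\<close>, of \<one> h2 n] \<open>h1 \<in> carrier G\<close> by auto
    then show ?case using walk_trans by blast
  qed
qed

lemma walk_exists:
  assumes u: "u \<in> carrier G" and v: "v \<in> carrier G"
  shows "\<exists>n. (u, v) \<in> edges ^^ n"
proof -
  obtain n where "(\<one>, inv u \<otimes> v) \<in> edges ^^ n" using walk_from_one[of "inv u \<otimes> v"] u v by auto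
  then have "(u \<otimes> \<one>, u \<otimes> (inv u \<otimes> v)) \<in> edges ^^ n" by (rule walk_left[OF u])
  moreover have "u \<otimes> (inv u \<otimes> v) = v" using u v by (simp add: m_assoc[symmetric])
  ultimately show ?thesis using u by auto
qed

lemma walk_vd: "u \<in> carrier G \<Longrightarrow> v \<in> carrier G \<Longrightarrow> (u, v) \<in> edges ^^ vd u v"
  unfolding vertex_dist_def by (rule LeastI_ex) (rule walk_exists)

lemma vd_le: "(u, v) \<in> edges ^^ n \<Longrightarrow> vd u v \<le> n"
  unfolding vertex_dist_def by (rule Least_le)

lemma vd_sym: "u \<in> carrier G \<Longrightarrow> v \<in> carrier G \<Longrightarrow> vd u v = vd v u"
  using vd_le[OF walk_sym[OF walk_vd[of u v]]] vd_le[OF walk_sym[OF walk_vd[of v u]]] by simp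

lemma vd_triangle:
  "u \<in> carrier G \<Longrightarrow> v \<in> carrier G \<Longrightarrow> w \<in> carrier G \<Longrightarrow> vd u w \<le> vd u v + vd v w"
  using walk_trans[OF walk_vd[of u v] walk_vd[of v w]] by (intro vd_le) blast

lemma vd_refl [simp]: "vd u u = 0"
  using vd_le[of u u 0] by simp

lemma vd_edge: "(u, v) \<in> edges \<Longrightarrow> vd u v \<le> 1"
  using vd_le[of u v 1] by simp

lemma vd_on_edge: "(u, v) \<in> edges \<Longrightarrow> x \<in> {u, v} \<Longrightarrow> y \<in> {u, v} \<Longrightarrow> vd x y \<le> 1"
  using vd_edge[of u v] vd_edge[OF edges_sym, of u v] by auto

lemma vd_left:
  assumes "g \<in> carrier G" "u \<in> carrier G" "v \<in> carrier G"
  shows "vd (g \<otimes> u) (g \<otimes> v) = vd u v"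
proof (rule antisym)
  show "vd (g \<otimes> u) (g \<otimes> v) \<le> vd u v" using assms by (intro vd_le walk_left walk_vd)
  have "(inv g \<otimes> (g \<otimes> u), inv g \<otimes> (g \<otimes> v)) \<in> edges ^^ vd (g \<otimes> u) (g \<otimes> v)"
    using assms by (intro walk_left walk_vd) auto
  then have "(u, v) \<in> edges ^^ vd (g \<otimes> u) (g \<otimes> v)"
    using assms by (simp add: m_assoc[symmetric])
  then show "vd u v \<le> vd (g \<otimes> u) (g \<otimes> v)" by (rule vd_le)
qed

definition geodesic_path :: "(nat \<Rightarrow> 'a) \<Rightarrow> nat \<Rightarrow> bool" where
  "geodesic_path \<gamma> N \<longleftrightarrow>
     \<gamma> 0 \<in> carrier G \<and> (\<forall>i<N. (\<gamma> i, \<gamma> (Suc i)) \<in> edges) \<and> N = vd (\<gamma> 0) (\<gamma> N)"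

lemma geodesic_path_exists:
  assumes "x \<in> carrier G" "y \<in> carrier G"
  shows "\<exists>\<gamma>. geodesic_path \<gamma> (vd x y) \<and> \<gamma> 0 = x \<and> \<gamma> (vd x y) = y"
  using walk_vd[OF assms] assms unfolding relpow_fun_conv geodesic_path_def by auto

lemma geodesic_path_through:
  assumes G: "x \<in> carrier G" "m \<in> carrier G" "y \<in> carrier G" and m: "vd x m + vd m y = vd x y"
  shows "\<exists>\<gamma>. geodesic_path \<gamma> (vd x y) \<and> \<gamma> 0 = x \<and> \<gamma> (vd x y) = y \<and> \<gamma> (vd x m) = m"
proof -
  let ?a = "vd x m" and ?b = "vd m y"
  obtain f where f: "f 0 = x" "f ?a = m" "\<And>i. i < ?a \<Longrightarrow> (f i, f (Suc i)) \<in> edges"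
    using walk_vd[OF G(1,2)] unfolding relpow_fun_conv by blast
  obtain g where g: "g 0 = m" "g ?b = y" "\<And>i. i < ?b \<Longrightarrow> (g i, g (Suc i)) \<in> edges"
    using walk_vd[OF G(2,3)] unfolding relpow_fun_conv by blast
  define \<gamma> where "\<gamma> i = (if i \<le> ?a then f i else g (i - ?a))" for i
  have "(\<gamma> i, \<gamma> (Suc i)) \<in> edges" if "i < vd x y" for i
  proof (cases "i < ?a")
    case True
    then show ?thesis using f(3) by (simp add: \<gamma>_def)
  next
    case False
    then have "(g (i - ?a), g (Suc (i - ?a))) \<in> edges" using that m by (intro g(3)) simp
    then show ?thesis using False f(2) g(1) by (cases "i = ?a") (simp_all add: \<gamma>_def Suc_diff_le)
  qed
  moreover have "\<gamma> (vd x y) = y"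
  proof (cases "?b = 0")
    case True
    then show ?thesis using m f(2) g(1,2) by (simp add: \<gamma>_def)
  next
    case False
    then show ?thesis using g(2) by (simp add: \<gamma>_def m[symmetric])
  qed
  ultimately show ?thesis using f G by (intro exI[of _ \<gamma>]) (simp add: geodesic_path_def \<gamma>_def)
qed

end

locale cayley_geodesic = cayley +
  fixes \<gamma> :: "nat \<Rightarrow> 'a" and N :: nat
  assumes geodesic: "geodesic_path \<gamma> N"
begin

lemma path_edge: "i < N \<Longrightarrow> (\<gamma> i, \<gamma> (Suc i)) \<in> edges"
  using geodesic by (simp add: geodesic_path_def)

lemma path_closed: "i \<le> N \<Longrightarrow> \<gamma> i \<in> carrier G"
proof (cases i)
  case (Suc k)
  assume "i \<le> N"
  then show ?thesis using Suc edges_closed[OF path_edge[of k]] by simp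
qed (use geodesic in \<open>simp add: geodesic_path_def\<close>)

lemma path_walk: "i + k \<le> N \<Longrightarrow> (\<gamma> i, \<gamma> (i + k)) \<in> edges ^^ k"
proof (induction k)
  case (Suc k)
  then show ?case using path_edge[of "i + k"] by auto
qed simp

lemma path_vd_le: "i \<le> j \<Longrightarrow> j \<le> N \<Longrightarrow> vd (\<gamma> i) (\<gamma> j) \<le> j - i"
  using vd_le[OF path_walk[of i "j - i"]] by simp

lemma path_vd:
  assumes "i \<le> j" "j \<le> N"
  shows "vd (\<gamma> i) (\<gamma> j) = j - i"
proof (rule antisym[OF path_vd_le[OF assms]])
  have "N \<le> vd (\<gamma> 0) (\<gamma> i) + vd (\<gamma> i) (\<gamma> j) + vd (\<gamma> j) (\<gamma> N)"
    using vd_triangle[of "\<gamma> 0" "\<gamma> i" "\<gamma> N"] vd_triangle[of "\<gamma> i" "\<gamma> j" "\<gamma> N"] assms path_closed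
      geodesic by (simp add: geodesic_path_def)
  then show "j - i \<le> vd (\<gamma> i) (\<gamma> j)"
    using path_vd_le[of 0 i] path_vd_le[of j N] assms by linarith
qed

lemma path_vd_real:
  assumes "i \<le> N" "j \<le> N"
  shows "real (vd (\<gamma> i) (\<gamma> j)) = \<bar>real i - real j\<bar>"
proof (cases "i \<le> j")
  case True
  then show ?thesis using path_vd[of i j] assms by (simp add: of_nat_diff)
next
  case False
  then show ?thesis using path_vd[of j i] vd_sym[of "\<gamma> i" "\<gamma> j"] path_closed assms by (simp add: of_nat_diff)
qed

lemma path_inj: "i \<le> N \<Longrightarrow> j \<le> N \<Longrightarrow> \<gamma> i = \<gamma> j \<longleftrightarrow> i = j"
  using path_vd_real[of i j] by auto

text \<open>
  The point at parameter \<open>s\<close> of the unit-speed geodesic through the vertices of \<open>\<gamma>\<close>, in barycentric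
  coordinates. Since \<open>vd (\<gamma> 0) (\<gamma> k) = k\<close>, the coordinate at \<open>\<gamma> k\<close> is the tent function
  \<open>max 0 (1 - \<bar>s - k\<bar>)\<close>. This single formula avoids a case distinction on the edge that contains the point.
\<close>

definition realize :: "real \<Rightarrow> 'a \<Rightarrow> real" where
  "realize s y = (if y \<in> \<gamma> ` {..N} then max 0 (1 - \<bar>s - vd (\<gamma> 0) y\<bar>) else 0)"

lemma realize_path: "k \<le> N \<Longrightarrow> realize s (\<gamma> k) = max 0 (1 - \<bar>s - k\<bar>)"
  using path_vd_real[of 0 k] by (simp add: realize_def)

lemma realize_off_path: "y \<notin> \<gamma> ` {..N} \<Longrightarrow> realize s y = 0"
  by (simp add: realize_def)

lemma support_realize: "point_support (realize s) = \<gamma> ` {k. k \<le> N \<and> \<bar>s - k\<bar> < 1}"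
proof
  show "point_support (realize s) \<subseteq> \<gamma> ` {k. k \<le> N \<and> \<bar>s - k\<bar> < 1}"
  proof
    fix y assume y: "y \<in> point_support (realize s)"
    then obtain k where k: "k \<le> N" "y = \<gamma> k"
      using realize_off_path[of y s] by (auto simp: point_support_def)
    then show "y \<in> \<gamma> ` {k. k \<le> N \<and> \<bar>s - k\<bar> < 1}"
      using y realize_path[of k s] by (auto simp: point_support_def)
  qed
qed (auto simp: point_support_def realize_path)

lemma realize_nat:
  assumes "k \<le> N"
  shows "realize (real k) = vertex_point (\<gamma> k)"
proof
  fix y
  show "realize (real k) y = vertex_point (\<gamma> k) y"
  proof (cases "y \<in> \<gamma> ` {..N}")
    case True
    then obtain j where "j \<le> N" "y = \<gamma> j" by auto
    then show ?thesis
      using realize_path[of j k] path_inj[of j k] assms by (cases "j = k") (auto simp: vertex_point_def)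
  next
    case False
    then show ?thesis using assms by (auto simp: realize_off_path vertex_point_def)
  qed
qed

lemma realize_edge:
  fixes s :: real
  assumes k: "k < N" and s: "real k \<le> s" "s \<le> real k + 1"
  shows "realize s = edge_point (\<gamma> k) (\<gamma> (Suc k)) (s - k)"
proof
  fix y
  have ne: "\<gamma> k \<noteq> \<gamma> (Suc k)" using path_inj[of k "Suc k"] k by simp
  show "realize s y = edge_point (\<gamma> k) (\<gamma> (Suc k)) (s - k) y"
  proof (cases "y \<in> \<gamma> ` {..N}")
    case True
    then obtain j where j: "j \<le> N" "y = \<gamma> j" by auto
    consider "j = k" | "j = Suc k" | "j \<noteq> k" "j \<noteq> Suc k" by blast
    then show ?thesis
    proof cases
      case 3
      then have "j + 1 \<le> k \<or> k + 2 \<le> j" by linarith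
      then have "1 \<le> \<bar>s - real j\<bar>" using s by linarith
      then show ?thesis using 3 j k path_inj[of j k] path_inj[of j "Suc k"]
        by (simp add: realize_path edge_point_def)
    qed (use j k s ne ne[symmetric] in \<open>simp_all add: realize_path edge_point_def\<close>)
  next
    case False
    then have "y \<noteq> \<gamma> k" "y \<noteq> \<gamma> (Suc k)" using k by auto
    then show ?thesis using False by (simp add: realize_off_path edge_point_def)
  qed
qed

lemma realize_in_graph:
  fixes s :: real
  assumes s: "0 \<le> s" "s \<le> N"
  shows "realize s \<in> cayley_graph G S"
proof (cases "s = N")
  case True
  then show ?thesis using realize_nat[of N] path_closed[of N] by (simp add: cayley_graph_def)
next
  case False
  define k where "k = nat \<lfloor>s\<rfloor>"
  have k: "k < N" "real k \<le> s" "s \<le> real k + 1" using s False unfolding k_def by linarith+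
  have "realize s = edge_point (\<gamma> k) (\<gamma> (Suc k)) (s - k)" by (rule realize_edge[OF k])
  moreover have "(\<gamma> k, \<gamma> (Suc k)) \<in> edges" using k by (intro path_edge)
  ultimately have "realize s \<in> {edge_point u v t | u v t. (u, v) \<in> edges \<and> 0 \<le> t \<and> t \<le> 1}"
    using k by (intro CollectI exI[of _ "\<gamma> k"] exI[of _ "\<gamma> (Suc k)"] exI[of _ "s - k"]) auto
  then show ?thesis unfolding cayley_graph_def by blast
qed

lemma index_in_support:
  fixes s :: real
  assumes "0 \<le> s" "s \<le> N"
  shows "\<gamma> (nat \<lfloor>s\<rfloor>) \<in> point_support (realize s)" "\<gamma> (nat \<lceil>s\<rceil>) \<in> point_support (realize s)"
proof -
  have "nat \<lfloor>s\<rfloor> \<le> N" "\<bar>s - nat \<lfloor>s\<rfloor>\<bar> < 1" "nat \<lceil>s\<rceil> \<le> N" "\<bar>s - nat \<lceil>s\<rceil>\<bar> < 1"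
    using assms by linarith+
  then show "\<gamma> (nat \<lfloor>s\<rfloor>) \<in> point_support (realize s)" "\<gamma> (nat \<lceil>s\<rceil>) \<in> point_support (realize s)"
    unfolding support_realize by blast+
qed

text \<open>
  If both points lie on a common edge, that edge may be taken to be one of the path, because vertices
  of the path at distance at most 1 have indices that differ by at most 1. Otherwise every candidate in
  the minimum has the form \<open>\<bar>s - m\<bar> + \<bar>m - n\<bar> + \<bar>t - n\<bar>\<close>, and the bound \<open>t - s\<close> is attained by
  rounding \<open>s\<close> up and \<open>t\<close> down.
\<close>

lemma cayley_dist_realize_le:
  fixes s t :: real
  assumes s: "0 \<le> s" and st: "s \<le> t" and t: "t \<le> N"
  shows "cayley_dist G S (realize s) (realize t) = t - s"
    and "cayley_dist G S (realize t) (realize s) = t - s"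
proof -
  define k l where "k = nat \<lceil>s\<rceil>" and "l = nat \<lfloor>t\<rfloor>"
  have kl: "real k - s < 1" "s \<le> real k" "t - real l < 1" "real l \<le> t" "k \<le> N" "l \<le> N"
    using s st t unfolding k_def l_def by linarith+
  let ?p = "realize s" and ?q = "realize t"
  let ?U = "point_support ?p \<union> point_support ?q"
  let ?near = "\<exists>(u, v) \<in> edges. ?U \<subseteq> {u, v}"
  let ?sum = "(\<Sum>x\<in>?U. \<bar>?p x - ?q x\<bar>) / 2"
  have sum: "?sum = t - s" if near: ?near
  proof (cases "s = t")
    case False
    define i where "i = nat \<lfloor>s\<rfloor>"
    have i: "real i \<le> s" "s < real i + 1" "i < N" using s st t False unfolding i_def by linarith+
    define j where "j = nat \<lceil>t\<rceil>"
    have j: "t \<le> real j" "real j - 1 < t" "j \<le> N" using s st t unfolding j_def by linarith+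
    have "\<gamma> i \<in> ?U" "\<gamma> j \<in> ?U"
      using index_in_support[of s] index_in_support[of t] s st t by (simp_all add: i_def j_def)
    moreover obtain u v where "(u, v) \<in> edges" "?U \<subseteq> {u, v}" using near by blast
    ultimately have "vd (\<gamma> i) (\<gamma> j) \<le> 1" by (meson subsetD vd_on_edge)
    then have "\<bar>real i - real j\<bar> \<le> 1" using path_vd_real[of i j] i j by simp
    moreover have "i < j" using i j st False by linarith
    ultimately have ji: "j = Suc i" by linarith
    have sub: "?U \<subseteq> {\<gamma> i, \<gamma> (Suc i)}"
    proof -
      have "n = i \<or> n = Suc i" if "\<bar>s - real n\<bar> < 1 \<or> \<bar>t - real n\<bar> < 1" for n :: nat
        using that i j ji st by linarith
      then show ?thesis unfolding support_realize by blast
    qed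
    have "(\<Sum>x\<in>?U. \<bar>?p x - ?q x\<bar>) = (\<Sum>x\<in>{\<gamma> i, \<gamma> (Suc i)}. \<bar>?p x - ?q x\<bar>)"
      using sub by (intro sum.mono_neutral_left) (auto simp: point_support_def)
    also have "\<dots> = 2 * (t - s)"
      using path_inj[of i "Suc i"] i j ji st by (simp add: realize_path)
    finally show ?thesis by simp
  qed simp
  let ?V = "{(1 - ?p u) + real (vd u v) + (1 - ?q v) | u v. u \<in> point_support ?p \<and> v \<in> point_support ?q}"
  let ?W = "{(1 - ?q v) + real (vd v u) + (1 - ?p u) | v u. v \<in> point_support ?q \<and> u \<in> point_support ?p}"
  have closed: "point_support (realize r) \<subseteq> carrier G" for r
    unfolding support_realize using path_closed by auto
  have VW: "?V = ?W"
  proof -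
    have "(1 - ?p u) + real (vd u v) + (1 - ?q v) = (1 - ?q v) + real (vd v u) + (1 - ?p u)"
      if "u \<in> point_support ?p" "v \<in> point_support ?q" for u v
      using vd_sym[of u v] closed[of s] closed[of t] that by auto
    then have "?V = {(1 - ?q v) + real (vd v u) + (1 - ?p u) | u v.
        u \<in> point_support ?p \<and> v \<in> point_support ?q}"
      by (intro Collect_cong) metis
    then show ?thesis by blast
  qed
  have min: "Min ?V = t - s" if far: "\<not> ?near"
  proof (rule Min_eqI)
    have fin: "finite (point_support (realize r))" for r
      unfolding support_realize by simp
    have "?V = (\<lambda>(u, v). (1 - ?p u) + real (vd u v) + (1 - ?q v)) ` (point_support ?p \<times> point_support ?q)"
      by auto
    then show "finite ?V" using fin by simp
    have val: "1 - realize r (\<gamma> n) = \<bar>r - n\<bar>" if "n \<le> N" "\<bar>r - n\<bar> < 1" for r n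
      using that by (simp add: realize_path)
    show "t - s \<le> y" if "y \<in> ?V" for y
    proof -
      obtain u v where uv: "y = (1 - ?p u) + real (vd u v) + (1 - ?q v)"
        "u \<in> point_support ?p" "v \<in> point_support ?q" using \<open>y \<in> ?V\<close> by blast
      obtain m n where mn: "u = \<gamma> m" "v = \<gamma> n" "m \<le> N" "n \<le> N" "\<bar>s - m\<bar> < 1" "\<bar>t - n\<bar> < 1"
        using uv(2,3) unfolding support_realize by blast
      have "y = \<bar>s - m\<bar> + \<bar>real m - real n\<bar> + \<bar>t - n\<bar>"
        using uv(1) mn val path_vd_real by simp
      then show ?thesis by linarith
    qed
    have "k \<le> l"
    proof (rule ccontr)
      assume "\<not> k \<le> l"
      then have lk: "l < k" by simp
      then have l: "real l < s" "t < real l + 1" using kl(1,3) by linarith+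
      have "l < N" using kl(5) lk by linarith
      have "n = l \<or> n = Suc l" if "\<bar>s - real n\<bar> < 1 \<or> \<bar>t - real n\<bar> < 1" for n :: nat
        using that l st by linarith
      then have "?U \<subseteq> {\<gamma> l, \<gamma> (Suc l)}" unfolding support_realize by blast
      then show False using far path_edge[OF \<open>l < N\<close>] by blast
    qed
    have "t - s = (1 - ?p (\<gamma> k)) + real (vd (\<gamma> k) (\<gamma> l)) + (1 - ?q (\<gamma> l))"
      using kl \<open>k \<le> l\<close> val[of k s] val[of l t] path_vd_real[of k l] by simp
    moreover have "\<gamma> k \<in> point_support ?p" "\<gamma> l \<in> point_support ?q"
      using index_in_support[of s] index_in_support[of t] s st t by (auto simp: k_def l_def)
    ultimately show "t - s \<in> ?V" by blast
  qed
  show "cayley_dist G S ?p ?q = t - s"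
    unfolding cayley_dist_def using sum min by simp
  have sum': "(\<Sum>x\<in>?U. \<bar>?q x - ?p x\<bar>) / 2 = ?sum"
    by (simp add: abs_minus_commute)
  show "cayley_dist G S ?q ?p = t - s"
    unfolding cayley_dist_def Un_commute[of "point_support ?q"] VW[symmetric] sum' using sum min by simp
qed

lemma cayley_dist_realize:
  assumes "s \<in> {0..real N}" "t \<in> {0..real N}"
  shows "cayley_dist G S (realize s) (realize t) = \<bar>s - t\<bar>"
  using assms cayley_dist_realize_le[of s t] cayley_dist_realize_le[of t s] by (cases "s \<le> t") auto

lemma geodesic_segment_realize:
  "geodesic_segment (cayley_graph G S) (cayley_dist G S) (vertex_point (\<gamma> 0)) (vertex_point (\<gamma> N))
     (realize ` {0..real N})"
proof -
  have e: "realize 0 = vertex_point (\<gamma> 0)" "realize N = vertex_point (\<gamma> N)"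
    using realize_nat[of 0] realize_nat[of N] by auto
  have d: "cayley_dist G S (vertex_point (\<gamma> 0)) (vertex_point (\<gamma> N)) = N"
    using cayley_dist_realize[of 0 N] e by simp
  show ?thesis
    unfolding geodesic_segment_def d
  proof (intro exI[of _ realize] conjI ballI)
    show "realize ` {0..real N} \<subseteq> cayley_graph G S" using realize_in_graph by auto
  qed (simp_all only: e cayley_dist_realize)
qed

text \<open>
  Passing from points of the realization to vertices costs at most the length of an edge.
\<close>

lemma near_vertex:
  assumes m: "m \<in> carrier G" and t: "t \<in> {0..real N}"
    and d: "cayley_dist G S (vertex_point m) (realize t) < \<delta>" and \<delta>: "0 \<le> \<delta>"
  shows "\<exists>j\<le>N. real (vd m (\<gamma> j)) \<le> \<delta> + 1"
proof -
  have supp_m: "point_support (vertex_point m) = {m}"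
    by (auto simp: point_support_def vertex_point_def)
  have t': "0 \<le> t" "t \<le> real N" using t by auto
  have j0: "\<gamma> (nat \<lfloor>t\<rfloor>) \<in> point_support (realize t)" by (rule index_in_support(1)[OF t'])
  have j0N: "nat \<lfloor>t\<rfloor> \<le> N" using t' by linarith
  show ?thesis
  proof (cases "\<exists>(u, v) \<in> edges. point_support (vertex_point m) \<union> point_support (realize t) \<subseteq> {u, v}")
    case True
    then obtain u v where "(u, v) \<in> edges" "point_support (vertex_point m) \<union> point_support (realize t) \<subseteq> {u, v}"
      by blast
    then have uv: "(u, v) \<in> edges" "m \<in> {u, v}" "\<gamma> (nat \<lfloor>t\<rfloor>) \<in> {u, v}"
      using j0 unfolding supp_m by blast+
    then have "vd m (\<gamma> (nat \<lfloor>t\<rfloor>)) \<le> 1" by (rule vd_on_edge)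
    then show ?thesis using j0N \<delta> by (intro exI[of _ "nat \<lfloor>t\<rfloor>"]) simp
  next
    case False
    let ?V = "{(1 - vertex_point m u) + real (vd u v) + (1 - realize t v) | u v.
      u \<in> point_support (vertex_point m) \<and> v \<in> point_support (realize t)}"
    have fin: "finite (point_support (realize t))" unfolding support_realize by simp
    have V: "?V = (\<lambda>v. real (vd m v) + (1 - realize t v)) ` point_support (realize t)"
      unfolding supp_m by (auto simp: vertex_point_def)
    have "Min ?V < \<delta>" using d False unfolding cayley_dist_def by simp
    moreover have "Min ?V \<in> ?V" unfolding V using fin j0 by (intro Min_in) auto
    ultimately obtain v where v: "v \<in> point_support (realize t)" "real (vd m v) + (1 - realize t v) < \<delta>"
      unfolding V by auto
    obtain j where j: "j \<le> N" "v = \<gamma> j" using v(1) unfolding support_realize by blast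
    have "realize t v \<le> 1" using j by (simp add: realize_path)
    then show ?thesis using v j by (intro exI[of _ j]) simp
  qed
qed

end

section \<open>Thin triangles and the four-point inequality\<close>

context cayley
begin

definition between :: "'a \<Rightarrow> 'a \<Rightarrow> 'a \<Rightarrow> bool" where
  "between x m y \<longleftrightarrow> m \<in> carrier G \<and> vd x m + vd m y = vd x y"

text \<open>
  The given vertex lies on a geodesic of the realization along an edge path through it, so hyperbolicity
  applies to it with this geodesic as one side; the other two sides may be chosen as edge paths, too.
\<close>

lemma slim_vertices:
  assumes hyp: "delta_hyperbolic G S \<delta>" and \<delta>: "0 \<le> \<delta>"
    and x: "x \<in> carrier G" and y: "y \<in> carrier G" and z: "z \<in> carrier G" and m: "between x m y"
  shows "\<exists>u. real (vd m u) \<le> \<delta> + 1 \<and> (between y u z \<or> between z u x)"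
proof -
  have mG: "m \<in> carrier G" "vd x m + vd m y = vd x y" using m by (auto simp: between_def)
  obtain f where f: "geodesic_path f (vd x y)" "f 0 = x" "f (vd x y) = y" "f (vd x m) = m"
    using geodesic_path_through[OF x mG(1) y mG(2)] by blast
  obtain g where g: "geodesic_path g (vd y z)" "g 0 = y" "g (vd y z) = z"
    using geodesic_path_exists[OF y z] by blast
  obtain h where h: "geodesic_path h (vd z x)" "h 0 = z" "h (vd z x) = x"
    using geodesic_path_exists[OF z x] by blast
  interpret f: cayley_geodesic G S f "vd x y" using f by unfold_locales
  interpret g: cayley_geodesic G S g "vd y z" using g by unfold_locales
  interpret h: cayley_geodesic G S h "vd z x" using h by unfold_locales
  let ?I = "f.realize ` {0..real (vd x y)}" and ?J = "g.realize ` {0..real (vd y z)}"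
    and ?K = "h.realize ` {0..real (vd z x)}"
  have "?I \<subseteq> open_nbhd (cayley_graph G S) (cayley_dist G S) \<delta> (?J \<union> ?K)"
    using hyp x y z f.geodesic_segment_realize g.geodesic_segment_realize h.geodesic_segment_realize
    unfolding delta_hyperbolic_def f g h by blast
  moreover have "vertex_point m \<in> ?I"
  proof -
    have "f.realize (real (vd x m)) = vertex_point m"
      using f.realize_nat[of "vd x m"] mG(2) f(4) by simp
    then show ?thesis using mG(2) by (intro image_eqI[of _ _ "real (vd x m)"]) auto
  qed
  ultimately have "vertex_point m \<in> open_nbhd (cayley_graph G S) (cayley_dist G S) \<delta> (?J \<union> ?K)" by blast
  then obtain q where q: "q \<in> ?J \<union> ?K" "cayley_dist G S (vertex_point m) q < \<delta>"
    unfolding open_nbhd_def by blast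
  from q(1) show ?thesis
  proof
    assume "q \<in> ?J"
    then obtain t where "t \<in> {0..real (vd y z)}" "q = g.realize t" by blast
    then obtain j where j: "j \<le> vd y z" "real (vd m (g j)) \<le> \<delta> + 1"
      using g.near_vertex[OF mG(1) _ _ \<delta>] q(2) by blast
    have "between y (g j) z"
      using g.path_vd[of 0 j] g.path_vd[of j "vd y z"] g.path_closed[of j] j(1) g(2,3)
      by (simp add: between_def)
    then show ?thesis using j(2) by blast
  next
    assume "q \<in> ?K"
    then obtain t where "t \<in> {0..real (vd z x)}" "q = h.realize t" by blast
    then obtain j where j: "j \<le> vd z x" "real (vd m (h j)) \<le> \<delta> + 1"
      using h.near_vertex[OF mG(1) _ _ \<delta>] q(2) by blast
    have "between z (h j) x"
      using h.path_vd[of 0 j] h.path_vd[of j "vd z x"] h.path_closed[of j] j(1) h(2,3)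
      by (simp add: between_def)
    then show ?thesis using j(2) by blast
  qed
qed

text \<open>
  Walking along a geodesic from \<open>x\<close> to \<open>y\<close>, the last vertex that is close to the side between \<open>w\<close> and
  \<open>x\<close> is also close to the side between \<open>y\<close> and \<open>w\<close>, as its successor is. By the triangle inequality its
  distance from \<open>w\<close> exceeds the Gromov product of \<open>x\<close> and \<open>y\<close> at \<open>w\<close> by at most a constant.
\<close>

lemma vertex_near_gromov_product:
  assumes hyp: "delta_hyperbolic G S \<delta>" and \<delta>: "0 \<le> \<delta>"
    and x: "x \<in> carrier G" and y: "y \<in> carrier G" and w: "w \<in> carrier G"
  shows "\<exists>m. between x m y \<and>
    2 * real (vd w m) \<le> real (vd w x) + real (vd w y) - real (vd x y) + 4 * \<delta> + 6"
proof -
  obtain f where f: "geodesic_path f (vd x y)" "f 0 = x" "f (vd x y) = y"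
    using geodesic_path_exists[OF x y] by blast
  interpret f: cayley_geodesic G S f "vd x y" using f by unfold_locales
  let ?N = "vd x y"
  have btw: "between x (f i) y" if "i \<le> ?N" for i
    using f.path_vd[of 0 i] f.path_vd[of i ?N] f.path_closed[of i] that f(2,3)
    by (simp add: between_def)
  define B where "B = {i. i \<le> ?N \<and> (\<exists>u. real (vd (f i) u) \<le> \<delta> + 1 \<and> between w u x)}"
  have fin: "finite B" by (rule finite_subset[of _ "{..?N}"]) (auto simp: B_def)
  have "between w x x" using x by (simp add: between_def)
  then have "0 \<in> B" using f(2) \<delta> by (auto simp: B_def intro!: exI[of _ x])
  then have ne: "B \<noteq> {}" by blast
  define i where "i = Max B"
  have "i \<in> B" unfolding i_def using fin ne by (rule Max_in)
  then obtain u where u: "i \<le> ?N" "real (vd (f i) u) \<le> \<delta> + 1" "between w u x"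
    by (auto simp: B_def)
  have m: "f i \<in> carrier G" using u(1) by (rule f.path_closed)
  have "\<exists>v. real (vd (f i) v) \<le> \<delta> + 2 \<and> between y v w"
  proof (cases "i = ?N")
    case True
    have "between y y w" using y by (simp add: between_def)
    then show ?thesis using True f(3) \<delta> by (intro exI[of _ y]) simp
  next
    case False
    then have iN: "Suc i \<le> ?N" using u(1) by simp
    have "Suc i \<notin> B" using Max_ge[OF fin, of "Suc i"] unfolding i_def by auto
    then have "\<not> (\<exists>u. real (vd (f (Suc i)) u) \<le> \<delta> + 1 \<and> between w u x)"
      using iN by (simp add: B_def)
    then obtain v where v: "real (vd (f (Suc i)) v) \<le> \<delta> + 1" "between y v w"
      using slim_vertices[OF hyp \<delta> x y w btw[OF iN]] by blast
    have "vd (f i) v \<le> vd (f i) (f (Suc i)) + vd (f (Suc i)) v"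
      using v(2) m iN by (intro vd_triangle f.path_closed) (auto simp: between_def)
    moreover have "vd (f i) (f (Suc i)) = 1" using f.path_vd[of i "Suc i"] iN by simp
    ultimately show ?thesis using v by (intro exI[of _ v]) auto
  qed
  then obtain v where v: "real (vd (f i) v) \<le> \<delta> + 2" "between y v w" by blast
  have uG: "u \<in> carrier G" and vG: "v \<in> carrier G" using u(3) v(2) by (auto simp: between_def)
  have "vd w u + vd u x = vd w x" "vd y v + vd v w = vd w y" "vd x (f i) + vd (f i) y = vd x y"
    using u(3) v(2) btw[OF u(1)] vd_sym[OF y w] by (auto simp: between_def)
  moreover have "vd w (f i) \<le> vd w u + vd (f i) u" "vd x (f i) \<le> vd u x + vd (f i) u"
    using vd_triangle[of w u "f i"] vd_triangle[of x u "f i"] vd_sym[of u "f i"] vd_sym[of x u] x w m uG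
    by simp_all
  moreover have "vd w (f i) \<le> vd v w + vd (f i) v" "vd (f i) y \<le> vd (f i) v + vd y v"
    using vd_triangle[of w v "f i"] vd_triangle[of "f i" v y] vd_sym[of v "f i"] vd_sym[of w v]
      vd_sym[of v y] y w m vG
    by simp_all
  ultimately have "2 * real (vd w (f i)) \<le> real (vd w x) + real (vd w y) - real (vd x y) + 4 * \<delta> + 6"
    using u(2) v(1) by linarith
  then show ?thesis using btw[OF u(1)] by blast
qed

text \<open>
  A vertex between \<open>y\<close> and \<open>z\<close> whose distance from \<open>w\<close> is about their Gromov product is close to one of the other two
  sides of the triangle with third vertex \<open>x\<close>, and the distance from \<open>w\<close> to a side is at least the
  Gromov product of its end points.
\<close>

lemma four_point_vertices:
  assumes hyp: "delta_hyperbolic G S \<delta>" and \<delta>: "0 \<le> \<delta>"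
    and w: "w \<in> carrier G" and x: "x \<in> carrier G" and y: "y \<in> carrier G" and z: "z \<in> carrier G"
  shows "real (vd w x) + real (vd y z) \<le>
    max (real (vd w y) + real (vd x z)) (real (vd w z) + real (vd x y)) + 2 * (3 * \<delta> + 4)"
proof -
  obtain m where m: "between y m z"
    "2 * real (vd w m) \<le> real (vd w y) + real (vd w z) - real (vd y z) + 4 * \<delta> + 6"
    using vertex_near_gromov_product[OF hyp \<delta> y z w] by blast
  obtain u where u: "real (vd m u) \<le> \<delta> + 1" "between z u x \<or> between x u y"
    using slim_vertices[OF hyp \<delta> y z x m(1)] by blast
  have mG: "m \<in> carrier G" and uG: "u \<in> carrier G" using m(1) u(2) by (auto simp: between_def)
  have tri: "real (vd p r) \<le> real (vd p q) + real (vd q r)"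
    if "p \<in> carrier G" "q \<in> carrier G" "r \<in> carrier G" for p q r
    using vd_triangle[OF that] by linarith
  note t = tri[OF w uG x] tri[OF w uG y] tri[OF w uG z] tri[OF w mG uG]
  from u(2) show ?thesis
  proof
    assume "between z u x"
    then have "real (vd u z) + real (vd u x) = real (vd x z)"
      using vd_sym[OF z uG] vd_sym[OF z x] by (simp add: between_def flip: of_nat_add)
    then have "real (vd w x) + real (vd y z) \<le> real (vd w y) + real (vd x z) + 2 * (3 * \<delta> + 4)"
      using m(2) u(1) t by argo
    then show ?thesis by linarith
  next
    assume "between x u y"
    then have "real (vd u x) + real (vd u y) = real (vd x y)"
      using vd_sym[OF x uG] by (simp add: between_def flip: of_nat_add)
    then have "real (vd w x) + real (vd y z) \<le> real (vd w z) + real (vd x y) + 2 * (3 * \<delta> + 4)"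
      using m(2) u(1) t by argo
    then show ?thesis by linarith
  qed
qed

lemma finite_vertex_ball: "finite {v. (\<one>, v) \<in> edges ^^ n}"
proof (induction n)
  case (Suc n)
  have "{v. (\<one>, v) \<in> edges ^^ Suc n} \<subseteq>
    (\<Union>u\<in>{v. (\<one>, v) \<in> edges ^^ n}. (\<lambda>s. u \<otimes> s) ` S \<union> (\<lambda>s. u \<otimes> inv s) ` S)"
  proof
    fix v assume "v \<in> {v. (\<one>, v) \<in> edges ^^ Suc n}"
    then obtain u where u: "(\<one>, u) \<in> edges ^^ n" "(u, v) \<in> edges" by auto
    then obtain s where s: "s \<in> S" "v = u \<otimes> s \<or> u = v \<otimes> s" and uv: "u \<in> carrier G" "v \<in> carrier G"
      unfolding cayley_edges_def by blast
    have "s \<in> carrier G" using s(1) S_closed by blast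
    then have "v = u \<otimes> s \<or> v = u \<otimes> inv s" using s(2) uv by (auto simp: m_assoc)
    then show "v \<in> (\<Union>u\<in>{v. (\<one>, v) \<in> edges ^^ n}. (\<lambda>s. u \<otimes> s) ` S \<union> (\<lambda>s. u \<otimes> inv s) ` S)"
      using u(1) s(1) by blast
  qed
  then show ?case using Suc finite_S by (elim finite_subset) blast
qed simp

lemma hyperbolic_length_vertex_dist:
  assumes hyp: "delta_hyperbolic G S \<delta>" and \<delta>: "0 \<le> \<delta>"
  shows "hyperbolic_length G (\<lambda>x. real (vd \<one> x)) (3 * \<delta> + 4)"
proof
  have shift: "vd \<one> (inv u \<otimes> v) = vd u v" if "u \<in> carrier G" "v \<in> carrier G" for u v
    using vd_left[of "inv u" u v] that by simp
  show "real (vd \<one> \<one>) = 0" by simp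
  show "real (vd \<one> (inv x)) = real (vd \<one> x)" if "x \<in> carrier G" for x
    using shift[of x \<one>] vd_sym[of x \<one>] that by simp
  show "real (vd \<one> (x \<otimes> y)) \<le> real (vd \<one> x) + real (vd \<one> y)"
    if "x \<in> carrier G" "y \<in> carrier G" for x y
    using vd_triangle[of \<one> x "x \<otimes> y"] vd_left[of x \<one> y] that by simp
  show "finite {x \<in> carrier G. real (vd \<one> x) \<le> r}" for r
  proof (rule finite_subset)
    show "{x \<in> carrier G. real (vd \<one> x) \<le> r} \<subseteq> (\<Union>n\<in>{..nat \<lfloor>r\<rfloor>}. {v. (\<one>, v) \<in> edges ^^ n})"
    proof
      fix x assume "x \<in> {x \<in> carrier G. real (vd \<one> x) \<le> r}"
      then have x: "x \<in> carrier G" "real (vd \<one> x) \<le> r" by auto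
      then have "vd \<one> x \<le> nat \<lfloor>r\<rfloor>" by linarith
      then show "x \<in> (\<Union>n\<in>{..nat \<lfloor>r\<rfloor>}. {v. (\<one>, v) \<in> edges ^^ n})"
        using walk_vd[OF one_closed x(1)] by blast
    qed
    show "finite (\<Union>n\<in>{..nat \<lfloor>r\<rfloor>}. {v. (\<one>, v) \<in> edges ^^ n})"
      using finite_vertex_ball by blast
  qed
  show "\<exists>u\<in>carrier G. \<exists>v\<in>carrier G. x = u \<otimes> v \<and> real (vd \<one> u) = real n \<and>
      real (vd \<one> v) = real (vd \<one> x) - real n"
    if x: "x \<in> carrier G" and n: "real n \<le> real (vd \<one> x)" for x n
  proof -
    obtain f where f: "geodesic_path f (vd \<one> x)" "f 0 = \<one>" "f (vd \<one> x) = x"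
      using geodesic_path_exists[OF one_closed x] by blast
    interpret f: cayley_geodesic G S f "vd \<one> x" using f by unfold_locales
    have n': "n \<le> vd \<one> x" using n by simp
    have u: "f n \<in> carrier G" using n' by (rule f.path_closed)
    have "vd \<one> (inv (f n) \<otimes> x) = vd \<one> x - n"
      using shift[OF u x] f.path_vd[of n "vd \<one> x"] n' f(3) by simp
    moreover have "vd \<one> (f n) = n" using f.path_vd[of 0 n] n' f(2) by simp
    moreover have "x = f n \<otimes> (inv (f n) \<otimes> x)" using u x by (simp add: m_assoc[symmetric])
    ultimately show ?thesis
      using u x n' by (intro bexI[of _ "f n"] bexI[of _ "inv (f n) \<otimes> x"]) (auto simp: of_nat_diff)
  qed
  show "real (vd \<one> (inv w \<otimes> x)) + real (vd \<one> (inv y \<otimes> z)) \<le>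
      max (real (vd \<one> (inv w \<otimes> y)) + real (vd \<one> (inv x \<otimes> z)))
        (real (vd \<one> (inv w \<otimes> z)) + real (vd \<one> (inv x \<otimes> y))) + 2 * (3 * \<delta> + 4)"
    if "w \<in> carrier G" "x \<in> carrier G" "y \<in> carrier G" "z \<in> carrier G" for w x y z
    using four_point_vertices[OF hyp \<delta>] that by (simp add: shift)
qed

end

theorem mainTheorem2:
  fixes G :: "('a, 'b) monoid_scheme" and a :: 'a and \<tau> :: "'a operator \<Rightarrow> complex"
  assumes "group G"
    and "word_hyperbolic G"
    and "\<not> elementary_group G"
    and "a \<in> carrier G"
    and "infinite (conjugacy_class G a)"
    and "cstar_trace G \<tau>"
  shows "\<tau> (regular_rep G a) = 0"
proof -
  obtain S \<delta> where S: "finite S" "S \<subseteq> carrier G" "generate G S = carrier G"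
    and \<delta>: "0 < \<delta>" "delta_hyperbolic G S \<delta>"
    using assms(2) unfolding word_hyperbolic_def by blast
  interpret group G by fact
  interpret cayley G S using S by unfold_locales
  interpret hyperbolic_length G "\<lambda>x. real (vertex_dist G S \<one>\<^bsub>G\<^esub> x)" "3 * \<delta> + 4"
    using \<delta> by (intro hyperbolic_length_vertex_dist) auto
  obtain g E where "powers_family a g E"
    using powers_family_if_not_elementary[OF assms(3-5)] by blast
  then show ?thesis using trace_vanishes_of_powers_family assms(4,6) by blast
qed

end
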